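(* Let $m\geqslant 2$, $k\geqslant 2$ and $n\geqslant 2m^k$. Write $\lambda=n\bmod m^k$ and $\lambda=\nu m^{k-1}+\mu$ with $0\leqslant\nu<m$ and $0\leqslant\mu<m^{k-1}$. Then the number of $\equiv_k$-equivalence classes of the set $\{(p_U,s_U)\mid U \text{ a factor of length } n \text{ of } \mathbf{t}_m\}$ equals \[(m^{k-1}-1)(m^3-m^2+m)+\begin{cases} b^{(1)}_{\mathbf{t}_m}(m+\nu), & \text{if }\mu=0;\\ m, &\text{otherwise.}\end{cases}\]
   Context: $\mathcal{A}_m=\{0,\ldots,m-1\}=\mathbb{Z}/m\mathbb{Z}$; $\sigma_m$ is the morphism $\sigma_m(i)=i\,(i+1)\cdots(i+m-1)$ (letters mod $m$), and $\mathbf{t}_m=\lim_{j\to\infty}\sigma_m^j(0)$. For $j\geqslant1$ and a factor $U$ of $\mathbf{t}_m$, a factorization $U=x\sigma_m^j(u)y$ is a $\sigma_m^j$-factorization if there is a factor $aub$ of $\mathbf{t}_m$ with $a,b\in\mathcal{A}_m\cup\{\varepsilon\}$, $x$ a proper suffix of $\sigma_m^j(a)$ and $y$ a proper prefix of $\sigma_m^j(b)$ ($\varepsilon$ counts as proper prefix/suffix of itself). Every factor $U$ of length $\geqslant 2m^k$ has a unique $\sigma_m^k$-factorization $U=p_U\sigma_m^k(u)s_U$, defining $(p_U,s_U)$. $\sim_1$ is abelian equivalence. $(p_1,s_1)\equiv_k(p_2,s_2)$ if there exist words $x,y,p,q,r,t$ with $|x|,|y|<m^{k-1}$, $(p_1,s_1)=(x\sigma_m^{k-1}(p),\sigma_m^{k-1}(q)y)$,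 $(p_2,s_2)=(x\sigma_m^{k-1}(r),\sigma_m^{k-1}(t)y)$, and one of $pq\sim_1 rt$, $pq\sim_1 rt\,\sigma_m(0)$, $pq\,\sigma_m(0)\sim_1 rt$ holds. $b^{(1)}_{\mathbf{t}_m}(n)$ is the abelian complexity: the number of $\sim_1$-classes of length-$n$ factors of $\mathbf{t}_m$. *)

theory Defs
  imports Complex_Main "HOL-Library.Multiset" "HOL-Library.Sublist"
begin

text \<open>Finite words are lists of natural numbers, infinite words are functions on the naturals.
  The letters of the alphabet of size \<open>m\<close> are the residues \<open>0, \<dots>, m - 1\<close>.\<close>

definition words :: "nat \<Rightarrow> nat list set" where
  "words m = lists {..<m}"

definition sigma_letter :: "nat \<Rightarrow> nat \<Rightarrow> nat list" where
  "sigma_letter m i = map (\<lambda>j. (i + j) mod m) [0..<m]"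

definition sigma :: "nat \<Rightarrow> nat list \<Rightarrow> nat list" where
  "sigma m w = concat (map (sigma_letter m) w)"

definition sigma_pow :: "nat \<Rightarrow> nat \<Rightarrow> nat list \<Rightarrow> nat list" where
  "sigma_pow m j = (sigma m ^^ j)"

text \<open>The word \<open>\<sigma>\<^sup>j(0)\<close> has length \<open>m ^ j\<close> and is a prefix of \<open>\<sigma>\<^sup>j\<^sup>+\<^sup>1(0)\<close>. As \<open>m ^ i > i\<close> for \<open>m \<ge> 2\<close>,
  the letter at position \<open>i\<close> of the limit can be read off \<open>\<sigma>\<^sup>i(0)\<close>;
  see \<open>tm_is_limit\<close> below.\<close>

definition tm :: "nat \<Rightarrow> nat \<Rightarrow> nat" where
  "tm m i = sigma_pow m i [0] ! i"

lemma sigma_append: "sigma m (u @ v) = sigma m u @ sigma m v"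
  by (simp add: sigma_def)

lemma length_sigma: "length (sigma m w) = m * length w"
  by (induction w) (auto simp: sigma_def sigma_letter_def)

lemma length_sigma_pow: "length (sigma_pow m j w) = m ^ j * length w"
  by (induction j) (auto simp: sigma_pow_def length_sigma)

lemma prefix_sigma: "prefix u v \<Longrightarrow> prefix (sigma m u) (sigma m v)"
  by (auto simp: prefix_def sigma_append)

lemma prefix_sigma_pow_Suc:
  assumes "m \<ge> 1"
  shows "prefix (sigma_pow m j [0]) (sigma_pow m (Suc j) [0])"
proof (induction j)
  case 0
  have "[0..<m] = 0 # [1..<m]"
    using assms by (simp add: upt_conv_Cons)
  then show ?case
    by (simp add: sigma_pow_def sigma_def sigma_letter_def)
next
  case (Suc j)
  from prefix_sigma[OF Suc, of m] show ?case
    by (simp add: sigma_pow_def)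
qed

lemma prefix_sigma_pow:
  assumes "m \<ge> 1" "i \<le> j"
  shows "prefix (sigma_pow m i [0]) (sigma_pow m j [0])"
  using assms(2)
proof (induction j rule: dec_induct)
  case base
  then show ?case by simp
next
  case (step j)
  then show ?case
    using prefix_sigma_pow_Suc[OF assms(1)] prefix_order.trans by blast
qed

lemma tm_is_limit:
  assumes "m \<ge> 2" "i < m ^ j"
  shows "tm m i = sigma_pow m j [0] ! i"
proof -
  have less: "i < m ^ i"
    using assms(1) power_gt_expt[of m i] by simp
  have pre: "sigma_pow m a [0] ! i = sigma_pow m b [0] ! i" if le: "a \<le> b" and lt: "i < m ^ a" for a b
  proof -
    obtain zs where "sigma_pow m b [0] = sigma_pow m a [0] @ zs"
      using prefix_sigma_pow[of m a b] assms(1) le by (auto elim: prefixE)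
    then show ?thesis
      using lt by (simp only: nth_append length_sigma_pow) simp
  qed
  show ?thesis
    using pre[of i j] pre[of j i] less assms(2) nat_le_linear[of i j] unfolding tm_def by metis
qed

definition is_factor :: "nat list \<Rightarrow> (nat \<Rightarrow> nat) \<Rightarrow> bool" where
  "is_factor U w \<longleftrightarrow> (\<exists>i. U = map w [i..<i + length U])"

definition factors :: "nat \<Rightarrow> nat \<Rightarrow> nat list set" where
  "factors m n = {U. is_factor U (tm m) \<and> length U = n}"

text \<open>The empty word counts as a proper prefix and a proper suffix of itself.\<close>

definition proper_prefix :: "nat list \<Rightarrow> nat list \<Rightarrow> bool" where
  "proper_prefix y w \<longleftrightarrow> strict_prefix y w \<or> (y = [] \<and> w = [])"

definition proper_suffix :: "nat list \<Rightarrow> nat list \<Rightarrow> bool" where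
  "proper_suffix x w \<longleftrightarrow> strict_suffix x w \<or> (x = [] \<and> w = [])"

text \<open>The words \<open>a\<close> and \<open>b\<close> of length at most one are a letter or the empty word.\<close>

definition sigma_factorization ::
    "nat \<Rightarrow> nat \<Rightarrow> nat list \<Rightarrow> nat list \<Rightarrow> nat list \<Rightarrow> nat list \<Rightarrow> bool" where
  "sigma_factorization m j U x u y \<longleftrightarrow>
     U = x @ sigma_pow m j u @ y \<and>
     (\<exists>a b. length a \<le> 1 \<and> length b \<le> 1 \<and> is_factor (a @ u @ b) (tm m) \<and>
        proper_suffix x (sigma_pow m j a) \<and> proper_prefix y (sigma_pow m j b))"

text \<open>The pair \<open>(p\<^sub>U, s\<^sub>U)\<close>; meaningful when the factorization is unique, in particular for all
  factors of length at least \<open>2 * m ^ k\<close>.\<close>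

definition border :: "nat \<Rightarrow> nat \<Rightarrow> nat list \<Rightarrow> nat list \<times> nat list" where
  "border m k U =
     (case (THE (p, u, s). sigma_factorization m k U p u s) of (p, u, s) \<Rightarrow> (p, s))"

definition abelian_equiv :: "nat list \<Rightarrow> nat list \<Rightarrow> bool" where
  "abelian_equiv u v \<longleftrightarrow> mset u = mset v"

definition abelian_complexity :: "nat \<Rightarrow> nat \<Rightarrow> nat" where
  "abelian_complexity m n =
     card (factors m n // {(u, v). u \<in> factors m n \<and> v \<in> factors m n \<and> abelian_equiv u v})"

text \<open>The words have to be over the alphabet: \<open>sigma\<close> does not distinguish the numbers \<open>i\<close> and
  \<open>i + m\<close>, while abelian equivalence does.\<close>

definition border_equiv ::
    "nat \<Rightarrow> nat \<Rightarrow> nat list \<times> nat list \<Rightarrow> nat list \<times> nat list \<Rightarrow> bool" where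
  "border_equiv m k P1 P2 \<longleftrightarrow>
     (\<exists>x \<in> words m. \<exists>y \<in> words m. \<exists>p \<in> words m. \<exists>q \<in> words m. \<exists>r \<in> words m. \<exists>t \<in> words m.
        length x < m ^ (k - 1) \<and> length y < m ^ (k - 1) \<and>
        P1 = (x @ sigma_pow m (k - 1) p, sigma_pow m (k - 1) q @ y) \<and>
        P2 = (x @ sigma_pow m (k - 1) r, sigma_pow m (k - 1) t @ y) \<and>
        (abelian_equiv (p @ q) (r @ t) \<or>
         abelian_equiv (p @ q) (r @ t @ sigma m [0]) \<or>
         abelian_equiv (p @ q @ sigma m [0]) (r @ t)))"

definition border_classes :: "nat \<Rightarrow> nat \<Rightarrow> nat \<Rightarrow> (nat list \<times> nat list) set set" where
  "border_classes m k n =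
     (let S = border m k ` factors m n
      in S // {(P1, P2). P1 \<in> S \<and> P2 \<in> S \<and> border_equiv m k P1 P2})"

end

theory Submission
  imports Defs "HOL-Number_Theory.Cong"
begin

text \<open>
  The letter of \<open>t\<^sub>m\<close> at position \<open>i\<close> is the digit sum of \<open>i\<close> in base \<open>m\<close>, modulo \<open>m\<close>. Two
  occurrences of a factor of length \<open>2 m\<^sup>k\<close> are congruent modulo \<open>m\<^sup>k\<close>, so the borders of a long factor are
  read off from any occurrence. As every pair of letters occurs at every positive distance, the
  borders are all pairs of a proper suffix of some \<open>\<sigma>\<^sup>k(a)\<close> and a proper prefix of some \<open>\<sigma>\<^sup>k(b)\<close>
  whose total length is \<open>n\<close> modulo \<open>m\<^sup>k\<close>.

  Write the borders as \<open>x \<sigma>\<^sup>k\<^sup>-\<^sup>1(p)\<close> and \<open>\<sigma>\<^sup>k\<^sup>-\<^sup>1(q) y\<close>. Their class is given by \<open>x\<close>, \<open>y\<close> and the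
  Parikh vector of \<open>p q\<close> modulo constant vectors, that is, its cyclic difference. If \<open>c\<close> is the letter before
  \<open>p\<close>, \<open>d\<close> the letter after \<open>q\<close>, \<open>i = |p|\<close> and \<open>e \<equiv> |p| + |q|\<close>, this difference is
  \<open>\<delta>(c+1) - \<delta>(c+1+i) + \<delta>(d-e+i) - \<delta>(d)\<close>. The word \<open>x\<close> determines \<open>c\<close> unless it is empty, and \<open>y\<close>
  determines \<open>d\<close> unless it is empty. Hence a length of \<open>x\<close> for which neither is empty contributes
  \<open>m + m(m-1)m\<close> classes, a length for which exactly one is empty contributes \<open>m(1 + m(m-1)/2)\<close>, and if both
  are empty the cyclic differences are those of the factors of length \<open>m + \<nu>\<close>.
\<close>

section \<open>The word as a digit sum\<close>

abbreviation tm_slice :: "nat \<Rightarrow> nat \<Rightarrow> nat \<Rightarrow> nat list" where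
  "tm_slice m a b \<equiv> map (tm m) [a..<b]"

lemma nth_sigma:
  assumes "q < length w" "r < m"
  shows "sigma m w ! (m * q + r) = (w ! q + r) mod m"
  using assms
proof (induction w arbitrary: q)
  case (Cons a w)
  have sig: "sigma m (a # w) = sigma_letter m a @ sigma m w"
    by (simp add: sigma_def)
  show ?case
  proof (cases q)
    case 0
    then show ?thesis using Cons.prems by (simp add: sig nth_append sigma_letter_def)
  next
    case (Suc q')
    have "sigma m w ! (m * q' + r) = (w ! q' + r) mod m"
      using Cons.IH[of q'] Cons.prems Suc by simp
    then show ?thesis using Suc by (simp add: sig nth_append sigma_letter_def)
  qed
qed simp

context
  fixes m :: nat
  assumes m2: "m \<ge> 2"
begin

text \<open>As q < m^q, the letter at q can be read in \<sigma>^q(0); one more application of the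
  morphism writes its block from position m q on.\<close>

lemma tm_mult_add:
  assumes "r < m"
  shows "tm m (m * q + r) = (tm m q + r) mod m"
proof -
  have q: "q < m ^ q" using m2 power_gt_expt[of m q] by simp
  then have "m * Suc q \<le> m * m ^ q" by (intro mult_le_mono) auto
  then have lt: "m * q + r < m ^ Suc q" using assms by simp
  show ?thesis
    using tm_is_limit[OF m2 lt] tm_is_limit[OF m2 q] nth_sigma[of q "sigma_pow m q [0]" r m] q assms
      length_sigma_pow[of m q "[0]"]
    by (simp add: sigma_pow_def)
qed

lemma tm_0: "tm m 0 = 0"
  by (simp add: tm_def sigma_pow_def)

lemma tm_less: "tm m i < m"
proof -
  have "tm m (m * (i div m) + i mod m) < m"
    by (subst tm_mult_add) (use m2 in auto)
  then show ?thesis by simp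
qed

lemma tm_small: "r < m \<Longrightarrow> tm m r = r"
  using tm_mult_add[of r 0] by (simp add: tm_0)

text \<open>Digit sums add up without carries when the summands use disjoint digit positions; the
  induction strips the last digit of \<open>r\<close>.\<close>

lemma tm_power_mult_add:
  assumes "r < m ^ k"
  shows "tm m (m ^ k * q + r) = (tm m q + tm m r) mod m"
  using assms
proof (induction k arbitrary: r)
  case 0
  then show ?case by (simp add: tm_0 tm_less)
next
  case (Suc k)
  define r' where "r' = r div m"
  define s where "s = r mod m"
  have s: "s < m" and r: "r = m * r' + s" using m2 by (auto simp: r'_def s_def)
  have "r' < m ^ k" using Suc.prems m2 unfolding r'_def
    by (simp add: less_mult_imp_div_less mult.commute)
  note IH = Suc.IH[OF this]
  have "m ^ Suc k * q + r = m * (m ^ k * q + r') + s"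
    by (simp add: r algebra_simps)
  then have "tm m (m ^ Suc k * q + r) = ((tm m q + tm m r') mod m + s) mod m"
    using tm_mult_add[OF s, of "m ^ k * q + r'"] IH by simp
  also have "\<dots> = (tm m q + tm m r) mod m"
    unfolding r tm_mult_add[OF s] by (simp add: mod_simps add.assoc)
  finally show ?case .
qed

section \<open>Slices of the word and the action of the morphism\<close>

lemma tm_slice_words: "tm_slice m a b \<in> words m"
  by (auto simp: words_def tm_less)

lemma tm_slice_append:
  "a \<le> b \<Longrightarrow> b \<le> c \<Longrightarrow> tm_slice m a b @ tm_slice m b c = tm_slice m a c"
  by (metis le_iff_add map_append upt_add_eq_append)

lemma sigma_tm_slice: "sigma m (tm_slice m a b) = tm_slice m (m * a) (m * b)"
proof (rule nth_equalityI)
  show "length (sigma m (tm_slice m a b)) = length (tm_slice m (m * a) (m * b))"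
    by (simp add: length_sigma diff_mult_distrib2)
next
  fix i assume "i < length (sigma m (tm_slice m a b))"
  then have i: "i < m * (b - a)" by (simp add: length_sigma)
  define q where "q = i div m"
  define r where "r = i mod m"
  have r: "r < m" and iq: "i = m * q + r" using m2 by (auto simp: q_def r_def)
  have q: "q < b - a" using i unfolding q_def by (simp add: less_mult_imp_div_less mult.commute)
  have "sigma m (tm_slice m a b) ! i = (tm m (a + q) + r) mod m"
    unfolding iq by (subst nth_sigma) (use q r in auto)
  also have "\<dots> = tm m (m * a + i)"
    using tm_mult_add[OF r, of "a + q"] by (simp add: iq algebra_simps)
  finally show "sigma m (tm_slice m a b) ! i = tm_slice m (m * a) (m * b) ! i"
    using i by (simp add: diff_mult_distrib2)
qed

lemma sigma_pow_tm_slice: "sigma_pow m k (tm_slice m a b) = tm_slice m (m ^ k * a) (m ^ k * b)"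
proof (induction k)
  case (Suc k)
  have "sigma_pow m (Suc k) (tm_slice m a b) = sigma m (sigma_pow m k (tm_slice m a b))"
    by (simp add: sigma_pow_def)
  then show ?case by (simp add: Suc sigma_tm_slice mult.assoc)
qed (simp add: sigma_pow_def)

lemma inj_on_sigma: "inj_on (sigma m) (words m)"
proof (rule inj_onI)
  fix u v assume uv: "u \<in> words m" "v \<in> words m" "sigma m u = sigma m v"
  have len: "length u = length v"
    using arg_cong[OF uv(3), of length] m2 by (simp add: length_sigma)
  show "u = v"
  proof (rule nth_equalityI[OF len])
    fix i assume i: "i < length u"
    have "u ! i mod m = v ! i mod m"
      using nth_sigma[of i u 0 m] nth_sigma[of i v 0 m] uv(3) i len m2 by simp
    moreover have "u ! i < m" "v ! i < m"
      using uv(1,2) i len by (auto simp: words_def in_lists_conv_set)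
    ultimately show "u ! i = v ! i" by simp
  qed
qed

lemma sigma_words: "sigma m u \<in> words m"
  using m2 by (auto simp: words_def sigma_def sigma_letter_def)

lemma inj_on_sigma_pow: "inj_on (sigma_pow m k) (words m)"
proof (induction k)
  case (Suc k)
  have "sigma_pow m k u \<in> words m" if "u \<in> words m" for u
    using that sigma_words by (cases k) (auto simp: sigma_pow_def)
  then show ?case
    using Suc inj_on_sigma by (auto simp: sigma_pow_def inj_on_def)
qed (simp add: sigma_pow_def)

section \<open>Pairs of letters at a prescribed distance\<close>

lemma tm_repunit: "tm m (m ^ r - 1) = r * (m - 1) mod m"
proof (induction r)
  case (Suc r)
  have "m ^ Suc r - 1 = m * (m ^ r - 1) + (m - 1)"
    using m2 by (simp add: diff_mult_distrib2)
  then have "tm m (m ^ Suc r - 1) = (r * (m - 1) mod m + (m - 1)) mod m"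
    using tm_mult_add[of "m - 1" "m ^ r - 1"] Suc m2 by simp
  then show ?case by (simp add: mod_simps add.commute)
qed (simp add: tm_0)

text \<open>Adding \<open>m\<^sup>l(m\<^sup>r - 1)\<close> to a number whose leading digit sits at position \<open>l\<close> causes
  exactly \<open>r\<close> carries, so the digit sums of the two ends of a gap differ by any prescribed residue.\<close>

lemma ex_tm_pair:
  assumes "d \<ge> 1" "a < m" "b < m"
  shows "\<exists>i. tm m i = a \<and> tm m (i + d) = b"
proof -
  obtain l where l: "m ^ l \<le> d" "d < m ^ Suc l"
    using ex_power_ivl1[OF m2 assms(1)] by auto
  define t where "t = d div m ^ l"
  define s where "s = d mod m ^ l"
  have s: "s < m ^ l" and d: "d = m ^ l * t + s" using m2 by (auto simp: t_def s_def)
  have t: "t \<ge> 1" using l m2 unfolding t_def by (simp add: div_greater_zero_iff Suc_le_eq)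
  have tm: "t < m" using l(2) unfolding t_def by (simp add: less_mult_imp_div_less)
  \<comment> \<open>The number of carries: \<open>i0\<close> below has digit sum -r modulo m and
    \<open>i0 + d\<close> has that of \<open>d\<close>, so \<open>r\<close> must be b - a -
    \<open>tm m d\<close> modulo m; the summand 2m avoids truncation.\<close>
  define r where "r = (b + 2 * m - a - tm m d) "
  define N where "N = Suc l + r"
  \<comment> \<open>A digit \<open>c\<close> at position \<open>N\<close>, above all digits of
    \<open>i0\<close> and of \<open>i0 + d\<close>, shifts both letters alike and makes the first
    one \<open>a\<close>.\<close>
  define c where "c = (a + r) mod m"
  have c: "c < m" using m2 by (simp add: c_def)
  define i0 where "i0 = m ^ l * (m ^ r - 1)"
  define i where "i = m ^ N * c + i0"
  have i0N: "i0 < m ^ N"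
  proof -
    have "i0 \<le> m ^ l * m ^ r" by (simp add: i0_def)
    also have "\<dots> < m ^ N" using m2 by (simp add: N_def power_add)
    finally show ?thesis .
  qed
  have rm: "(r * (m - 1) + r) mod m = 0" 
  proof -
    have "r * (m - 1) + r = r * m" using m2 by (cases m) auto
    then show ?thesis by simp
  qed
  have i0: "tm m i0 = r * (m - 1) mod m"
    using tm_power_mult_add[of 0 l "m ^ r - 1"] m2 tm_repunit[of r] by (simp add: i0_def tm_0 tm_less)
  have "tm m i = (c + r * (m - 1) mod m) mod m"
    unfolding i_def using tm_power_mult_add[OF i0N, of c] tm_small[OF c] i0 by simp
  also have "\<dots> = (a + (r * (m - 1) + r)) mod m"
    by (simp add: c_def mod_simps algebra_simps)
  also have "\<dots> = a" using rm assms(2)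
    by (metis add.right_neutral mod_add_right_eq mod_less)
  finally have A: "tm m i = a" .
  \<comment> \<open>For r > 0 the carry runs through the \<open>r\<close> digits m - 1, leaving t -
    1 in place of \<open>t\<close> and a new digit 1 on top, so the digit sum of \<open>d\<close> is
    kept.\<close>
  have e: "i0 + d = m ^ l * (m ^ r + (t - 1)) + s"
  proof -
    have "m ^ r - 1 + t = m ^ r + (t - 1)" using t m2 by simp
    then show ?thesis by (simp add: i0_def d flip: add_mult_distrib2)
  qed
  have B0: "tm m (i0 + d) = tm m d"
  proof (cases "r = 0")
    case True then show ?thesis by (simp add: i0_def)
  next
    case False
    then have "m ^ 1 \<le> m ^ r" using m2 by (intro power_increasing) auto
    then have "t - 1 < m ^ r" using tm by simp
    then have "tm m (m ^ r + (t - 1)) = (1 + (t - 1)) mod m"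
      using tm_power_mult_add[of "t - 1" r 1] tm_small[of 1] tm_small[of "t - 1"] m2 tm by simp
    then have "tm m (m ^ r + (t - 1)) = tm m t" using t tm tm_small[OF tm] by simp
    then show ?thesis
      using tm_power_mult_add[OF s] unfolding e by (simp add: d)
  qed
  have i0d: "i0 + d < m ^ N"
  proof (cases "r = 0")
    case True then show ?thesis using l by (simp add: i0_def N_def)
  next
    case False
    have "m ^ r + (t - 1) + 1 \<le> m ^ r + m ^ r"
    proof -
      have "m ^ 1 \<le> m ^ r" using m2 False by (intro power_increasing) auto
      then show ?thesis using tm by simp
    qed
    also have "\<dots> \<le> m ^ Suc r" using mult_right_mono[OF m2, of "m ^ r"] by (simp flip: mult_2)
    finally have "m ^ l * (m ^ r + (t - 1) + 1) \<le> m ^ l * m ^ Suc r" by (rule mult_le_mono2)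
    moreover have "i0 + d < m ^ l * (m ^ r + (t - 1) + 1)" unfolding e using s by simp
    ultimately show ?thesis by (simp add: N_def power_add mult.commute mult.left_commute)
  qed
  have "tm m (i + d) = (c + tm m d) mod m"
    using tm_power_mult_add[OF i0d, of c] tm_small[OF c] B0 by (simp add: i_def add.assoc)
  also have "\<dots> = (a + r + tm m d) mod m" by (simp add: c_def mod_simps)
  also have "\<dots> = b"
    using tm_less[of d] assms(2,3) by (simp add: r_def)
  finally show ?thesis using A by blast
qed

text \<open>Starting positions are made positive so that the next multiple of the block length is
  positive too, as \<open>cut_data\<close> demands.\<close>

lemma ex_factor_occurrence_pos:
  "\<exists>j\<ge>1. tm_slice m i (i + n) = tm_slice m j (j + n)"
proof -
  define N where "N = i + n"
  have lt: "i + n < m ^ N" using m2 power_gt_expt[of m N] by (simp add: N_def)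
  \<comment> \<open>The digits 1 and m - 1 sum to m, so writing them in front of the low
    \<open>N\<close> digits changes no letter.\<close>
  have "tm m (m * 1 + (m - 1)) = 0"
    using tm_mult_add[of "m - 1" 1] tm_small[of 1] m2 by simp
  then have q: "tm m (m ^ N * (m * 1 + (m - 1)) + r) = tm m r" if "r < m ^ N" for r
    using tm_power_mult_add[OF that] tm_less by simp
  define j where "j = m ^ N * (m * 1 + (m - 1)) + i"
  have "tm_slice m i (i + n) = tm_slice m j (j + n)"
  proof (rule nth_equalityI)
    fix l assume "l < length (tm_slice m i (i + n))"
    then show "tm_slice m i (i + n) ! l = tm_slice m j (j + n) ! l"
      using q[of "i + l"] lt by (simp add: j_def add.assoc)
  qed simp
  moreover have "j \<ge> 1"
    using m2 by (auto simp: j_def Suc_le_eq)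
  ultimately show ?thesis by blast
qed

section \<open>Synchronisation of the occurrences of a long factor\<close>

lemma tm_Suc_same: "Suc n mod m \<noteq> 0 \<Longrightarrow> tm m (Suc n) = (tm m n + 1) mod m"
proof -
  assume A: "Suc n mod m \<noteq> 0"
  define r where "r = n mod m"
  have "Suc r < m" using A m2 unfolding r_def
    by (metis Suc_lessI mod_Suc mod_less_divisor not_numeral_le_zero zero_less_iff_neq_zero)
  moreover have "n = m * (n div m) + r" by (simp add: r_def)
  ultimately show ?thesis
    using tm_mult_add[of r "n div m"] tm_mult_add[of "Suc r" "n div m"]
    by (metis Suc_eq_plus1 Suc_lessD add_Suc_right mod_add_left_eq add.assoc)
qed

text \<open>The cyclic successor of the last letter of \<sigma>(a) is a again, whereas the next
  block starts with a + 1, because passing from q - 1 to q causes no carry.\<close>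

lemma tm_mult_jump:
  assumes "q \<ge> 1" "q mod m \<noteq> 0"
  shows "tm m (m * q) \<noteq> (tm m (m * q - 1) + 1) mod m"
proof -
  have 1: "m * q - 1 = m * (q - 1) + (m - 1)"
    using assms m2 by (cases q) auto
  have 2: "tm m (m * q) = tm m q" using tm_mult_add[of 0 q] m2 tm_less by simp
  have "(tm m (m * q - 1) + 1) mod m = (tm m (q - 1) + (m - 1) + 1) mod m"
    unfolding 1 using tm_mult_add[of "m - 1" "q - 1"] m2 by (simp add: mod_Suc_eq)
  also have "\<dots> = tm m (q - 1)" using m2 tm_less[of "q - 1"] by simp
  finally have 3: "(tm m (m * q - 1) + 1) mod m = tm m (q - 1)" .
  have "tm m q = (tm m (q - 1) + 1) mod m"
    using tm_Suc_same[of "q - 1"] assms by simp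
  moreover have "\<dots> \<noteq> tm m (q - 1)"
    using tm_less[of "q - 1"] m2 by (auto simp: mod_Suc)
  ultimately show ?thesis using 2 3 by simp
qed

text \<open>A letter visibly breaks the cyclic succession at every multiple of \<open>m\<close> that is not a
  multiple of \<open>m\<^sup>2\<close>, and of two consecutive multiples of \<open>m\<close> at least one is of this kind.\<close>

lemma sync_mod_m:
  assumes eq: "\<And>l. l < 2 * m \<Longrightarrow> tm m (P + l) = tm m (P' + l)"
  shows "P mod m = P' mod m"
proof -
  \<comment> \<open>The residues differ, so one is nonzero, and by symmetry it may be that of
    \<open>P\<close>; then two multiples of m lie strictly inside the window of length 2m at
    \<open>P\<close>.\<close>
  have aux: False
    if eq: "\<And>l. l < 2 * m \<Longrightarrow> tm m (P + l) = tm m (P' + l)"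
      and ne: "P mod m \<noteq> P' mod m" and nz: "P mod m \<noteq> 0" for P P'
  proof -
    define q where "q = P div m"
    define o1 where "o1 = m - P mod m"
    have Pm: "P mod m < m" using m2 by simp
    have o: "0 < o1" "o1 < m" using nz Pm by (auto simp: o1_def)
    have P: "P + o1 = m * (q + 1)"
    proof -
      have "P = m * q + P mod m" by (simp add: q_def)
      then show ?thesis using Pm unfolding o1_def by (simp add: algebra_simps)
    qed
    obtain h where h: "h \<in> {q + 1, q + 2}" "h mod m \<noteq> 0"
    proof (cases "(q + 1) mod m = 0")
      case True
      then have "(q + 2) mod m \<noteq> 0" using m2 mod_Suc[of "q+1" m] by auto
      then show ?thesis using that by blast
    qed (use that in blast)
    define l where "l = m * h - P"
    have l: "P + l = m * h" "0 < l" "l < 2 * m"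
      using h(1) P o by (auto simp: l_def algebra_simps)
    have l': "P + (l - 1) = m * h - 1" using l by simp
    have "tm m (P + l) \<noteq> (tm m (P + (l - 1)) + 1) mod m"
      unfolding l(1) l' using tm_mult_jump[of h] h by auto
    then have "tm m (P' + l) \<noteq> (tm m (P' + (l - 1)) + 1) mod m"
      using eq[of l] eq[of "l - 1"] l by simp
    then have "(P' + l) mod m = 0"
      using tm_Suc_same[of "P' + (l - 1)"] l(2) by auto
    moreover have "(P + l) mod m = 0" using l(1) by simp
    ultimately have "P mod m = P' mod m"
      using cong_add_rcancel_nat[of P l P' m] by (simp add: cong_def)
    then show False using ne by simp
  qed
  show ?thesis
  proof (rule ccontr)
    assume ne: "P mod m \<noteq> P' mod m"
    show False
      using aux[of P P', OF eq ne] aux[of P' P] eq ne by (metis)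
  qed
qed

text \<open>Every m-th letter, read from a multiple of m on, gives the word again; once both
  positions are aligned modulo m, the claim descends from k + 1 to k.\<close>

lemma sync_mod_power:
  assumes "\<And>l. l < 2 * m ^ k \<Longrightarrow> tm m (P + l) = tm m (P' + l)"
  shows "P mod m ^ k = P' mod m ^ k"
  using assms
proof (induction k arbitrary: P P')
  case (Suc k)
  have "2 * m \<le> 2 * m ^ Suc k" using m2 by simp
  then have mm: "P mod m = P' mod m"
    using sync_mod_m[of P P'] Suc.prems by (meson order.strict_trans2)
  define r where "r = (m - P mod m) mod m"
  have r: "r < m" using m2 by (simp add: r_def)
  have dv: "m dvd (X + r)" if "X mod m = P mod m" for X
  proof -
    have "X mod m < m" using m2 by simp
    have "(X + r) mod m = (X mod m + (m - X mod m)) mod m"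
      unfolding r_def that[symmetric] by (simp add: mod_simps)
    also have "\<dots> = 0" using \<open>X mod m < m\<close> by simp
    finally show ?thesis by auto
  qed
  obtain Q where Q: "P + r = m * Q" using dv[of P] by auto
  obtain Q' where Q': "P' + r = m * Q'" using dv[of P'] mm by auto
  have "Q mod m ^ k = Q' mod m ^ k"
  proof (rule Suc.IH)
    fix l assume l: "l < 2 * m ^ k"
    have "m * Suc l \<le> m * (2 * m ^ k)" using l by (intro mult_le_mono) auto
    then have "r + m * l < 2 * m ^ Suc k" using r by (simp add: algebra_simps)
    then have "tm m (P + (r + m * l)) = tm m (P' + (r + m * l))" using Suc.prems by blast
    moreover have "P + (r + m * l) = m * (Q + l)" "P' + (r + m * l) = m * (Q' + l)"
      using Q Q' by (simp_all add: algebra_simps)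
    moreover have "tm m (m * x) = tm m x" for x using tm_mult_add[of 0 x] m2 tm_less by simp
    ultimately show "tm m (Q + l) = tm m (Q' + l)" by simp
  qed
  then have "(P + r) mod m ^ Suc k = (P' + r) mod m ^ Suc k"
    unfolding Q Q' power_Suc by (simp only: mult_mod_right[symmetric])
  then show ?case using cong_add_rcancel_nat[of P r P' "m ^ Suc k"] by (simp add: cong_def)
qed simp

lemma factors_eq: "factors m n = (\<lambda>i. tm_slice m i (i + n)) ` {1..}"
  using ex_factor_occurrence_pos[of _ n] 
  by (auto simp: factors_def is_factor_def image_iff Bex_def) metis

end

section \<open>Parikh vectors and borders\<close>

lemma sigma_pow_append: "sigma_pow m k (u @ v) = sigma_pow m k u @ sigma_pow m k v"
  by (induction k) (simp_all add: sigma_pow_def sigma_append)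

lemma sigma_pow_Nil: "sigma_pow m k [] = []"
  using length_sigma_pow[of m k "[]"] by simp

text \<open>The classes are the images under \<open>g\<close> of the fibres of \<open>f\<close>.
  Where \<open>g\<close> identifies two parameters, the assumption forces \<open>f\<close> to agree
  on them.\<close>

lemma card_quotient_image:
  assumes "\<And>s t. s \<in> A \<Longrightarrow> t \<in> A \<Longrightarrow> R (g s) (g t) \<longleftrightarrow> f s = f t"
  shows "card (g ` A // {(a, b). a \<in> g ` A \<and> b \<in> g ` A \<and> R a b}) = card (f ` A)"
proof -
  define F where "F v = g ` {t \<in> A. f t = v}" for v
  have "{(a, b). a \<in> g ` A \<and> b \<in> g ` A \<and> R a b} `` {g s} = F (f s)" if "s \<in> A" for s
    using assms[OF that] that by (auto simp: F_def image_iff)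
  then have "g ` A // {(a, b). a \<in> g ` A \<and> b \<in> g ` A \<and> R a b} = F ` f ` A"
    by (auto simp: quotient_def image_iff)
  moreover have "inj_on F (f ` A)"
  proof (rule inj_onI, clarsimp)
    fix s t assume st: "s \<in> A" "t \<in> A" "F (f s) = F (f t)"
    have "g s \<in> F (f s)" using st by (auto simp: F_def)
    then obtain r where "r \<in> A" "f r = f t" "g s = g r" using st by (auto simp: F_def)
    then show "f s = f t" using assms[of s r] assms[of s s] st by metis
  qed
  ultimately show ?thesis by (simp add: card_image)
qed

section \<open>Cyclic differences of Parikh vectors\<close>

definition residue_ind :: "nat \<Rightarrow> int \<Rightarrow> int \<Rightarrow> int" where
  "residue_ind m a z = of_bool ([z = a] (mod int m))"

lemma residue_ind_cong: "[a = b] (mod int m) \<Longrightarrow> residue_ind m a = residue_ind m b"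
  by (auto simp: residue_ind_def cong_def fun_eq_iff)

text \<open>Differencing around the cycle kills exactly the constant vectors: blocks \<sigma>(a)
  become invisible, and the length recovers the lost constant.\<close>

definition cyc_diff :: "nat \<Rightarrow> nat list \<Rightarrow> int \<Rightarrow> int" where
  "cyc_diff m w z =
     int (count (mset w) (nat (z mod int m))) - int (count (mset w) (nat ((z - 1) mod int m)))"

lemma cyc_diff_append: "cyc_diff m (u @ v) z = cyc_diff m u z + cyc_diff m v z"
  by (simp add: cyc_diff_def)

lemma cyc_diff_Nil: "cyc_diff m [] z = 0"
  by (simp add: cyc_diff_def)

lemma length_eq_sum_count: "w \<in> words m \<Longrightarrow> length w = (\<Sum>z<m. count (mset w) z)"
proof (induction w)
  case (Cons a w)
  have "count (mset (a # w)) z = count (mset w) z + of_bool (z = a)" for z by simp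
  then show ?case using Cons by (simp add: words_def sum.distrib)
qed simp

lemma count_words_ge: "w \<in> words m \<Longrightarrow> \<not> z < m \<Longrightarrow> count (mset w) z = 0"
  by (auto simp: words_def count_eq_zero_iff in_lists_conv_set)

lemma words_append: "u \<in> words m \<Longrightarrow> v \<in> words m \<Longrightarrow> u @ v \<in> words m"
  by (simp add: words_def)

context
  fixes m :: nat
  assumes m2: "m \<ge> 2"
begin

lemma cyc_diff_letter:
  assumes "b < m"
  shows "cyc_diff m [b] z = residue_ind m (int b) z - residue_ind m (int b + 1) z"
proof -
  have "b = nat (y mod int m) \<longleftrightarrow> [y = int b] (mod int m)" for y
    using assms m2 by (auto simp: cong_def nat_eq_iff2)
  moreover have "[z - 1 = int b] (mod int m) \<longleftrightarrow> [z = int b + 1] (mod int m)"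
    using cong_add_rcancel[of "z - 1" 1 "int b" "int m"] by simp
  ultimately show ?thesis by (simp add: cyc_diff_def residue_ind_def)
qed

text \<open>A letter b contributes the indicator of b minus that of b + 1, and the sum telescopes
  along cyclically consecutive letters.\<close>

lemma cyc_diff_run:
  assumes "\<And>l. l < length w \<Longrightarrow> w ! l < m \<and> [int (w ! l) = s + int l] (mod int m)"
  shows "cyc_diff m w z = residue_ind m s z - residue_ind m (s + int (length w)) z"
  using assms
proof (induction w rule: rev_induct)
  case (snoc b w)
  have b: "b < m" "[int b = s + int (length w)] (mod int m)"
    using snoc.prems[of "length w"] by auto
  have "w ! l < m \<and> [int (w ! l) = s + int l] (mod int m)" if "l < length w" for l
    using snoc.prems[of l] that by (auto simp: nth_append)
  note IH = snoc.IH[OF this]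
  have "[int b + 1 = s + int (length w) + 1] (mod int m)"
    using b(2) cong_add_rcancel by blast
  then show ?case
    using IH cyc_diff_letter[OF b(1), of z] residue_ind_cong[OF b(2)] residue_ind_cong[of "int b + 1"]
    by (simp add: cyc_diff_append add.assoc add.commute[of 1])
qed (simp add: cyc_diff_Nil)

lemma cyc_diff_sigma: "cyc_diff m (sigma m w) z = 0"
proof (induction w)
  case (Cons a w)
  have "cyc_diff m (sigma_letter m a) z =
      residue_ind m (int a) z - residue_ind m (int a + int (length (sigma_letter m a))) z"
    by (rule cyc_diff_run) (use m2 in \<open>auto simp: sigma_letter_def cong_def zmod_int\<close>)
  also have "\<dots> = 0"
    using residue_ind_cong[of "int a + int m" "int a" m] by (simp add: sigma_letter_def cong_def)
  finally show ?case using Cons cyc_diff_append[of m "sigma_letter m a" "sigma m w" z]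
    by (simp add: sigma_def)
qed (simp add: sigma_def cyc_diff_Nil)

text \<open>Equal differences carry the discrepancy at letter 0 over to all letters; summing over
  the alphabet gives m times that discrepancy.\<close>

lemma cyc_diff_eqD:
  assumes uv: "u \<in> words m" "v \<in> words m" and eq: "cyc_diff m u = cyc_diff m v"
  obtains c where "\<And>z. z < m \<Longrightarrow> int (count (mset u) z) = int (count (mset v) z) + c"
    "int (length u) = int (length v) + int m * c"
proof -
  define c where "c = int (count (mset u) 0) - int (count (mset v) 0)"
  have c: "int (count (mset u) z) = int (count (mset v) z) + c" if "z < m" for z
    using that
  proof (induction z)
    case (Suc z)
    have "int (Suc z) mod int m = int (Suc z)" "(int (Suc z) - 1) mod int m = int z"
      using Suc.prems by (auto simp flip: zmod_int)
    then show ?case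
      using fun_cong[OF eq, of "int (Suc z)"] Suc by (simp only: cyc_diff_def nat_int)
  qed (simp add: c_def)
  have "int (length u) = (\<Sum>z<m. int (count (mset v) z) + c)"
    unfolding length_eq_sum_count[OF uv(1)] using c by simp
  also have "\<dots> = int (length v) + int m * c"
    unfolding length_eq_sum_count[OF uv(2)] by (simp add: sum.distrib)
  finally show ?thesis using c that by blast
qed

lemma abelian_equiv_iff_cyc_diff:
  assumes uv: "u \<in> words m" "v \<in> words m" and len: "length u = length v"
  shows "abelian_equiv u v \<longleftrightarrow> cyc_diff m u = cyc_diff m v"
proof
  assume "cyc_diff m u = cyc_diff m v"
  then obtain c where c: "\<And>z. z < m \<Longrightarrow> int (count (mset u) z) = int (count (mset v) z) + c"
    "int (length u) = int (length v) + int m * c"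
    using cyc_diff_eqD[OF uv] by blast
  then have "c = 0" using len m2 by simp
  then have "count (mset u) z = count (mset v) z" for z
    using c(1)[of z] count_words_ge[OF uv(1), of z] count_words_ge[OF uv(2), of z]
    by (cases "z < m") (simp_all del: count_mset_0_iff)
  then show "abelian_equiv u v" unfolding abelian_equiv_def by (intro multiset_eqI) auto
qed (auto simp: abelian_equiv_def cyc_diff_def fun_eq_iff)

text \<open>The Parikh vectors differ by a constant c, and the length bounds give |c| < 2; the
  values 0, 1, -1 are the three alternatives in \<open>border_equiv\<close>.\<close>

lemma abelian_equiv_sigma_iff_cyc_diff:
  assumes uv: "u \<in> words m" "v \<in> words m" and len: "length u < 2 * m" "length v < 2 * m"
  shows "abelian_equiv u v \<or> abelian_equiv u (v @ sigma m [0]) \<or> abelian_equiv (u @ sigma m [0]) v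
    \<longleftrightarrow> cyc_diff m u = cyc_diff m v" (is "?L \<longleftrightarrow> ?R")
proof
  have ab: "cyc_diff m u = cyc_diff m v" if "abelian_equiv u v" for u v
    using that by (auto simp: abelian_equiv_def cyc_diff_def fun_eq_iff)
  have app: "cyc_diff m (w @ sigma m [0]) = cyc_diff m w" for w
    by (rule ext) (simp add: cyc_diff_append cyc_diff_sigma)
  assume ?L
  then show ?R using ab app by metis
next
  assume eq: ?R
  then obtain c where c: "int (length u) = int (length v) + int m * c"
    using cyc_diff_eqD[OF uv] by blast
  have app: "cyc_diff m (w @ sigma m [0]) = cyc_diff m w" for w
    by (rule ext) (simp add: cyc_diff_append cyc_diff_sigma)
  have s: "sigma m [0] \<in> words m" "length (sigma m [0]) = m"
    by (auto simp: sigma_words[OF m2] length_sigma)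
  have "int m * c < int m * 2" "int m * (-2) < int m * c" using c len by linarith+
  then have "c < 2" "-2 < c" using m2 by (auto simp only: mult_less_cancel_left)
  then consider "c = 0" | "c = 1" | "c = -1" by linarith
  then show ?L
  proof cases
    case 1
    then show ?thesis using abelian_equiv_iff_cyc_diff[OF uv] c eq by simp
  next
    case 2
    then show ?thesis
      using abelian_equiv_iff_cyc_diff[OF uv(1) words_append[OF uv(2) s(1)]] c eq app s by simp
  next
    case 3
    then show ?thesis
      using abelian_equiv_iff_cyc_diff[OF words_append[OF uv(1) s(1)] uv(2)] c eq app s by simp
  qed
qed

section \<open>Existence and uniqueness of factorizations\<close>

lemma sigma_factorization_occurs:
  assumes "sigma_factorization m k U x u y"
  obtains N where "length x \<le> m ^ k * N"
    "U = tm_slice m (m ^ k * N - length x) (m ^ k * N - length x + length U)"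
    "length x < m ^ k" "length y < m ^ k" "u \<in> words m"
proof -
  define L where "L = m ^ k"
  have L: "L > 0" using m2 by (simp add: L_def)
  obtain a b i where U: "U = x @ sigma_pow m k u @ y" and ab: "length a \<le> 1" "length b \<le> 1"
    and i: "a @ u @ b = tm_slice m i (i + length (a @ u @ b))"
    and xa: "proper_suffix x (sigma_pow m k a)" and yb: "proper_prefix y (sigma_pow m k b)"
    using assms unfolding sigma_factorization_def is_factor_def by metis
  have lx: "length x < L"
    using xa ab(1) L suffix_length_less[of x "sigma_pow m k a"]
    by (auto simp: proper_suffix_def length_sigma_pow simp flip: L_def)
       (metis One_nat_def le_Suc_eq le_zero_eq mult.right_neutral mult_0_right not_less_zero)
  have ly: "length y < L"
    using yb ab(2) L prefix_length_less[of y "sigma_pow m k b"]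
    by (auto simp: proper_prefix_def length_sigma_pow simp flip: L_def)
       (metis One_nat_def le_Suc_eq le_zero_eq mult.right_neutral mult_0_right not_less_zero)
  have u: "u \<in> words m"
  proof -
    have "a @ u @ b \<in> words m" by (subst i) (rule tm_slice_words[OF m2])
    then show ?thesis by (simp add: words_def)
  qed
  \<comment> \<open>Completing \<open>x\<close> and \<open>y\<close> to full images makes
    \<open>U\<close> the middle part of the image of a u b, which is a slice between multiples of
    m^k.\<close>
  obtain x' where x': "sigma_pow m k a = x' @ x"
    using xa by (auto simp: proper_suffix_def strict_suffix_def suffix_def)
  obtain y' where y': "sigma_pow m k b = y @ y'"
    using yb by (auto simp: proper_prefix_def strict_prefix_def prefix_def)
  have lx': "length x' + length x = L * length a"
    using arg_cong[OF x', of length] by (simp add: length_sigma_pow L_def)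
  have ly': "length y + length y' = L * length b"
    using arg_cong[OF y', of length] by (simp add: length_sigma_pow L_def)
  have "x' @ U @ y' = sigma_pow m k (a @ u @ b)"
    by (simp add: sigma_pow_append x' y' U)
  also have "\<dots> = tm_slice m (L * i) (L * (i + length (a @ u @ b)))"
    by (subst i) (simp add: sigma_pow_tm_slice[OF m2] L_def)
  finally have eq: "x' @ U @ y' = tm_slice m (L * i) (L * (i + length (a @ u @ b)))" .
  have lU: "length U = length x + L * length u + length y"
    by (simp add: U length_sigma_pow L_def)
  have "U = take (length U) (drop (length x') (x' @ U @ y'))" by simp
  also have "\<dots> = tm_slice m (L * i + length x') (L * i + length x' + length U)"
    unfolding eq drop_map take_map drop_upt
    by (subst take_upt) (use lx' ly' lU in \<open>auto simp: algebra_simps\<close>)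
  finally have fin: "U = tm_slice m (L * i + length x') (L * i + length x' + length U)" .
  have e: "L * i + length x' = L * (i + length a) - length x"
    using lx' by (simp add: algebra_simps)
  have le: "length x \<le> L * (i + length a)"
    using lx' by (simp add: algebra_simps)
  show ?thesis
    by (rule that[of "i + length a"]) (use fin[unfolded e] le lx ly u in \<open>simp_all only: L_def\<close>)
qed

lemma sigma_factorization_tm_slice:
  assumes P: "P + i = m ^ k * Q" "i < m ^ k" and E: "P + n = m ^ k * R + j" "j < m ^ k"
    and QR: "Q \<le> R"
  shows "sigma_factorization m k (tm_slice m P (P + n))
    (tm_slice m P (m ^ k * Q)) (tm_slice m Q R) (tm_slice m (m ^ k * R) (P + n))"
proof -
  define L where "L = m ^ k"
  \<comment> \<open>An empty overhang gets an empty neighbour, so no letter before position 0 is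
    asked for: Q = 0 forces i = 0.\<close>
  define a where "a = (if i = 0 then Q else Q - 1)"
  define b where "b = (if j = 0 then R else R + 1)"
  have Q: "Q \<ge> 1" if "i \<noteq> 0" using P that by (cases Q) auto
  have ab: "a \<le> Q" "R \<le> b" by (auto simp: a_def b_def)
  have le: "P \<le> L * Q" "L * Q \<le> L * R" "L * R \<le> P + n"
    using P E QR by (auto simp: L_def)
  have "tm_slice m a Q @ tm_slice m Q R @ tm_slice m R b = tm_slice m a b"
    using ab QR tm_slice_append[OF m2] by simp
  then have fac: "is_factor (tm_slice m a Q @ tm_slice m Q R @ tm_slice m R b) (tm m)"
    using ab QR by (auto simp: is_factor_def intro!: exI[of _ a])
  have suf: "proper_suffix (tm_slice m P (L * Q)) (sigma_pow m k (tm_slice m a Q))"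
  proof (cases "i = 0")
    case True
    then show ?thesis using P by (simp add: proper_suffix_def a_def L_def sigma_pow_Nil)
  next
    case False
    have aP: "L * a < P" "L * a \<le> L * Q" 
    proof -
      have "L * a + L = L * Q" using False Q by (cases Q) (simp_all add: a_def)
      then show "L * a < P" using P unfolding L_def by linarith
      show "L * a \<le> L * Q" using ab by simp
    qed
    have "tm_slice m (L * a) (L * Q) = tm_slice m (L * a) P @ tm_slice m P (L * Q)"
      using tm_slice_append[OF m2, of "L * a" P "L * Q"] aP le by simp
    then show ?thesis using aP
      by (auto simp: proper_suffix_def sigma_pow_tm_slice[OF m2] strict_suffix_def suffix_def
          simp flip: L_def)
  qed
  have pre: "proper_prefix (tm_slice m (L * R) (P + n)) (sigma_pow m k (tm_slice m R b))"
  proof (cases "j = 0")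
    case True
    then show ?thesis using E by (simp add: proper_prefix_def b_def L_def sigma_pow_Nil)
  next
    case False
    have bP: "P + n < L * b" using E False by (simp add: b_def L_def)
    have "tm_slice m (L * R) (L * b) = tm_slice m (L * R) (P + n) @ tm_slice m (P + n) (L * b)"
      using tm_slice_append[OF m2, of "L * R" "P + n" "L * b"] bP le by simp
    then show ?thesis using bP
      by (auto simp: proper_prefix_def sigma_pow_tm_slice[OF m2] strict_prefix_def prefix_def
          simp flip: L_def)
  qed
  have "tm_slice m P (P + n) = tm_slice m P (L * Q) @ sigma_pow m k (tm_slice m Q R) @ tm_slice m (L * R) (P + n)"
    unfolding sigma_pow_tm_slice[OF m2] L_def[symmetric]
    using le by (metis le_trans tm_slice_append[OF m2])
  then show ?thesis
    unfolding sigma_factorization_def L_def[symmetric]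
    using fac suf pre
    by (intro conjI exI[of _ "tm_slice m a Q"] exI[of _ "tm_slice m R b"]) (auto simp: a_def b_def)
qed

text \<open>Synchronisation fixes |p| modulo m^k, hence |p|; dividing the remaining length by m^k
  fixes |u|; injectivity of the morphism on words over the alphabet fixes u.\<close>

lemma sigma_factorization_unique:
  assumes 1: "sigma_factorization m k U p u s" and 2: "sigma_factorization m k U p' u' s'"
    and len: "length U \<ge> 2 * m ^ k"
  shows "p = p' \<and> u = u' \<and> s = s'"
proof -
  define L where "L = m ^ k"
  have U: "U = p @ sigma_pow m k u @ s" "U = p' @ sigma_pow m k u' @ s'"
    using 1 2 by (auto simp: sigma_factorization_def)
  obtain N where N: "length p \<le> L * N" "U = tm_slice m (L * N - length p) (L * N - length p + length U)"
    "length p < L" "length s < L" "u \<in> words m"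
    using sigma_factorization_occurs[OF 1] unfolding L_def by blast
  obtain N' where N': "length p' \<le> L * N'" "U = tm_slice m (L * N' - length p') (L * N' - length p' + length U)"
    "length p' < L" "length s' < L" "u' \<in> words m"
    using sigma_factorization_occurs[OF 2] unfolding L_def by blast
  define P where "P = L * N - length p"
  define P' where "P' = L * N' - length p'"
  have "tm m (P + l) = tm m (P' + l)" if "l < 2 * m ^ k" for l
  proof -
    have l: "l < length U" using that len by simp
    have "U ! l = tm m (P + l)" using l by (subst N(2)) (simp add: P_def)
    moreover have "U ! l = tm m (P' + l)" using l by (subst N'(2)) (simp add: P'_def)
    ultimately show ?thesis by simp
  qed
  then have "P mod L = P' mod L" unfolding L_def by (rule sync_mod_power[OF m2])
  then have "(P' + length p) mod L = (P + length p) mod L" by (metis mod_add_left_eq)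
  also have "\<dots> = 0" using N(1) by (simp add: P_def)
  also have "0 = (P' + length p') mod L" using N'(1) by (simp add: P'_def)
  finally have "[length p = length p'] (mod L)"
    using cong_add_lcancel_nat by (simp add: cong_def)
  then have lp: "length p = length p'" using N(3) N'(3) by (simp add: cong_def)
  then have p: "p = p'" and us: "sigma_pow m k u @ s = sigma_pow m k u' @ s'" using U by auto
  have "L * length u + length s = L * length u' + length s'"
    using arg_cong[OF us, of length] by (simp add: length_sigma_pow L_def)
  then have "(L * length u + length s) div L = (L * length u' + length s') div L" by simp
  then have "length u = length u'" using N(3,4) N'(4) by simp
  then have "sigma_pow m k u = sigma_pow m k u'" "s = s'"
    using us by (auto simp: length_sigma_pow)
  then show ?thesis using p inj_on_sigma_pow[OF m2] N(5) N'(5) by (auto dest: inj_onD)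
qed

lemma border_tm_slice:
  assumes P: "P + i = m ^ k * Q" "i < m ^ k" and E: "P + n = m ^ k * R + j" "j < m ^ k"
    and n: "n \<ge> 2 * m ^ k"
  shows "border m k (tm_slice m P (P + n)) = (tm_slice m P (m ^ k * Q), tm_slice m (m ^ k * R) (P + n))"
proof -
  have "m ^ k * Q < m ^ k * (R + 1)" using P E n by simp
  then have QR: "Q \<le> R" by (simp only: mult_less_cancel1) simp
  note fac = sigma_factorization_tm_slice[OF P E QR]
  have "(THE (p, u, s). sigma_factorization m k (tm_slice m P (P + n)) p u s) =
      (tm_slice m P (m ^ k * Q), tm_slice m Q R, tm_slice m (m ^ k * R) (P + n))"
  proof (rule the_equality)
    fix z assume z: "case z of (p, u, s) \<Rightarrow> sigma_factorization m k (tm_slice m P (P + n)) p u s"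
    obtain p u s where psu: "z = (p, u, s)" by (cases z)
    then have "sigma_factorization m k (tm_slice m P (P + n)) p u s" using z by simp
    from sigma_factorization_unique[OF this fac] n psu
    show "z = (tm_slice m P (m ^ k * Q), tm_slice m Q R, tm_slice m (m ^ k * R) (P + n))" by simp
  qed (simp only: prod.case fac)
  then show ?thesis by (simp add: border_def)
qed

text \<open>The slice is the end of the image of the letter at C - 1, that is, a fixed word
  translated by this letter; any one of its positions reveals the translation.\<close>

lemma tm_slice_before_eq_iff:
  assumes "C \<ge> 1" "C' \<ge> 1" "i < m ^ k"
  shows "tm_slice m (m ^ k * C - i) (m ^ k * C) = tm_slice m (m ^ k * C' - i) (m ^ k * C')
    \<longleftrightarrow> i = 0 \<or> tm m (C - 1) = tm m (C' - 1)"
proof -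
  define K where "K = m ^ k"
  have s: "tm_slice m (K * C - i) (K * C) = map (\<lambda>r. (tm m (C - 1) + tm m r) mod m) [K - i..<K]"
    if "C \<ge> 1" for C
  proof (rule nth_equalityI)
    have KC: "K * C = K * (C - 1) + K" using that by (cases C) auto
    show "length (tm_slice m (K * C - i) (K * C)) = length (map (\<lambda>r. (tm m (C - 1) + tm m r) mod m) [K - i..<K])"
      using assms(3) KC by (simp add: K_def)
    fix l assume "l < length (tm_slice m (K * C - i) (K * C))"
    then have l: "l < i" by simp
    have idx: "K * C - i + l = K * (C - 1) + (K - i + l)" and r: "K - i + l < K"
      using l KC assms(3) by (auto simp: K_def)
    have lt: "K * C - i + l < K * C" using l KC assms(3) by (simp add: K_def)
    have "tm_slice m (K * C - i) (K * C) ! l = tm m (K * C - i + l)" using lt by simp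
    also have "\<dots> = (tm m (C - 1) + tm m (K - i + l)) mod m"
      unfolding idx using tm_power_mult_add[OF m2, of "K - i + l" k "C - 1"] r by (simp add: K_def)
    also have "\<dots> = map (\<lambda>r. (tm m (C - 1) + tm m r) mod m) [K - i..<K] ! l"
      using l assms(3) by (subst nth_map_upt) (simp_all add: K_def)
    finally show "tm_slice m (K * C - i) (K * C) ! l = map (\<lambda>r. (tm m (C - 1) + tm m r) mod m) [K - i..<K] ! l" .
  qed
  have "tm m (C - 1) = tm m (C' - 1)"
    if "(tm m (C - 1) + x) mod m = (tm m (C' - 1) + x) mod m" for x
    using that cong_add_rcancel_nat[of "tm m (C - 1)" x "tm m (C' - 1)" m] tm_less[OF m2]
    by (simp add: cong_def)
  then show ?thesis
    unfolding K_def[symmetric] s[OF assms(1)] s[OF assms(2)]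
    by (cases "i = 0") (use assms(3) in \<open>auto simp flip: K_def dest!: bspec[of _ _ "K - 1"]\<close>)
qed

lemma tm_slice_after_eq_iff:
  assumes "j < m ^ k"
  shows "tm_slice m (m ^ k * D) (m ^ k * D + j) = tm_slice m (m ^ k * D') (m ^ k * D' + j)
    \<longleftrightarrow> j = 0 \<or> tm m D = tm m D'"
proof -
  define K where "K = m ^ k"
  have s: "tm_slice m (K * D) (K * D + j) = map (\<lambda>r. (tm m D + tm m r) mod m) [0..<j]" for D
    by (rule nth_equalityI) (use assms tm_power_mult_add[OF m2, of _ k D] in \<open>auto simp: K_def\<close>)
  have "tm m D = tm m D'"
    if "(tm m D + x) mod m = (tm m D' + x) mod m" for x
    using that cong_add_rcancel_nat[of "tm m D" x "tm m D'" m] tm_less[OF m2]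
    by (simp add: cong_def)
  then show ?thesis
    unfolding K_def[symmetric] s
    by (cases "j = 0") (auto dest!: bspec[of _ _ 0])
qed

end

section \<open>Counting cyclic differences\<close>

text \<open>The cyclic difference of the Parikh vector of \<open>p q\<close>, where \<open>p\<close> is the run of \<open>i\<close> letters
  starting after the letter \<open>c\<close> and \<open>q\<close> is a run of \<open>e - i\<close> letters (modulo \<open>m\<close>) ending before
  the letter \<open>d\<close>.\<close>

definition jump :: "nat \<Rightarrow> int \<Rightarrow> int \<Rightarrow> int \<Rightarrow> int \<Rightarrow> int \<Rightarrow> int" where
  "jump m c d e i z = residue_ind m (c + 1) z - residue_ind m (c + 1 + i) z
     + residue_ind m (d - e + i) z - residue_ind m d z"

lemma jump_cong:
  assumes "[c = c'] (mod int m)" "[d = d'] (mod int m)" "[e = e'] (mod int m)" "[i = i'] (mod int m)"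
  shows "jump m c d e i = jump m c' d' e' i'"
proof -
  have "[c + 1 = c' + 1] (mod int m)" "[c + 1 + i = c' + 1 + i'] (mod int m)"
    "[d - e + i = d' - e' + i'] (mod int m)"
    using assms by (auto intro!: cong_add cong_diff)
  then show ?thesis
    using assms residue_ind_cong by (auto simp: jump_def fun_eq_iff)
qed

text \<open>The flags tell whether the outer pieces of the two borders are nonempty and thus reveal
  the letters c and d; a hidden letter is replaced by 0.\<close>

definition jump_entry ::
    "nat \<Rightarrow> bool \<Rightarrow> bool \<Rightarrow> int \<Rightarrow> int \<times> int \<times> int \<Rightarrow> int \<times> int \<times> (int \<Rightarrow> int)" where
  "jump_entry m x y e = (\<lambda>(c, d, i).
     (if x then c mod int m else 0, if y then d mod int m else 0, jump m c d e i))"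

context
  fixes m :: nat
  assumes m2: "m \<ge> 2"
begin

lemma residue_ind_add_nat:
  "p < m \<Longrightarrow> s < m \<Longrightarrow> residue_ind m (B + int p) (B + int s) = of_bool (s = p)"
  by (auto simp: residue_ind_def cong_add_lcancel cong_int_iff cong_less_modulus_unique_nat)

lemma range_mod_int:
  assumes "\<And>i. f (i mod int m) = f i"
  shows "range f = f ` {0..<int m}"
proof -
  have "f i \<in> f ` {0..<int m}" for i
    by (rule image_eqI[of _ _ "i mod int m"]) (use assms m2 in auto)
  then show ?thesis by blast
qed

text \<open>If A and B are incongruent, the moving part is 1 only at A + i, which reveals i modulo
  m; otherwise the moving part vanishes.\<close>

lemma card_range_translates:
  "card (range (\<lambda>i z. g z + (residue_ind m (A + i) z - residue_ind m (B + i) z))) =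
     (if [A = B] (mod int m) then 1 else m)" (is "card (range ?f) = _")
proof (cases "[A = B] (mod int m)")
  case True
  then have "[A + i = B + i] (mod int m)" for i by (simp add: cong_add)
  then have "?f = (\<lambda>i. g)" using residue_ind_cong by (fastforce simp: fun_eq_iff)
  then have "range ?f = {g}" by (simp only:) simp
  then show ?thesis using True by simp
next
  case False
  have per: "?f (i mod int m) = ?f i" for i
  proof -
    have "[A + i mod int m = A + i] (mod int m)" "[B + i mod int m = B + i] (mod int m)"
      by (simp_all add: cong_def mod_simps)
    then show ?thesis using residue_ind_cong by (auto simp: fun_eq_iff)
  qed
  have "inj_on ?f {0..<int m}"
  proof (rule inj_onI)
    fix i i' assume i: "i \<in> {0..<int m}" "i' \<in> {0..<int m}" "?f i = ?f i'"
    have "\<not> [A + i = B + i] (mod int m)" using False by (simp add: cong_add_rcancel)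
    then have "residue_ind m (A + i') (A + i) - residue_ind m (B + i') (A + i) = 1"
      using fun_cong[OF i(3), of "A + i"] by (simp add: residue_ind_def)
    then have "[A + i = A + i'] (mod int m)"
      by (auto simp: residue_ind_def of_bool_def split: if_splits)
    then have "[i = i'] (mod int m)" by (simp add: cong_add_lcancel)
    then show "i = i'" using i by (simp add: cong_def)
  qed
  then show ?thesis using False range_mod_int[of ?f, OF per] by (simp add: card_image)
qed

text \<open>Up to congruence the triples \<open>(P, R, P + R - B)\<close> with \<open>P, R \<noteq> B\<close> have no cancellation, so
  the unordered pair \<open>{P, R}\<close> can be read off; the degenerate triples all give the indicator of \<open>B\<close>.\<close>

lemma card_range_pairs:
  "card (range (\<lambda>(P, R) z. residue_ind m P z + residue_ind m R z - residue_ind m (P + R - B) z)) =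
     1 + m * (m - 1) div 2" (is "card (range ?F) = _")
proof -
  define h where "h = (\<lambda>(p, r) z. residue_ind m (B + int p) z + residue_ind m (B + int r) z
    - residue_ind m (B + int (p + r)) z)"
  define T where "T = (SIGMA r:{1..<m}. {1..r})"
  define T' where "T' = prod.swap ` T"
  have T': "(p, r) \<in> T' \<longleftrightarrow> 1 \<le> p \<and> p \<le> r \<and> r < m" for p r
    by (auto simp: T'_def T_def image_iff)
  have card_T': "card T' = m * (m - 1) div 2"
  proof -
    have "card T = (\<Sum>r\<in>{1..<m}. r)" by (simp add: T_def)
    also have "\<dots> = \<Sum>{0..<m}"
      using m2 by (simp add: sum.atLeast_Suc_lessThan)
    also have "\<dots> = m * (m - 1) div 2" using Sum_Ico_nat[of 0 m] by simp
    finally show ?thesis by (simp add: T'_def card_image)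
  qed
  have hv: "h (p, r) (B + int s) =
      of_bool (s = p) + of_bool (s = r) - of_bool ([s = p + r] (mod m))"
    if "p < m" "r < m" "s < m" for p r s
  proof -
    have "[B + int s = B + int (p + r)] (mod int m) \<longleftrightarrow> [s = p + r] (mod m)"
      unfolding cong_add_lcancel cong_int_iff ..
    then show ?thesis
      using that by (simp add: h_def residue_ind_add_nat) (simp add: residue_ind_def)
  qed
  \<comment> \<open>Neither of two nonzero offsets is congruent to their sum, so the negative term
    cancels no positive one.\<close>
  have nc: "\<not> [p = p + r] (mod m)" "\<not> [r = p + r] (mod m)" if "1 \<le> p" "1 \<le> r" "p < m" "r < m" for p r
  proof -
    have "\<not> m dvd r" "\<not> m dvd p" using that by (auto dest: dvd_imp_le)
    then show "\<not> [p = p + r] (mod m)" "\<not> [r = p + r] (mod m)"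
      using cong_add_lcancel_0_nat[of p r m] cong_add_rcancel_0_nat[of p r m]
      by (auto simp: cong_0_iff cong_sym_eq[of p] cong_sym_eq[of r])
  qed
  have supp: "{s \<in> {..<m}. h (p, r) (B + int s) > 0} = {p, r}" if "(p, r) \<in> T'" for p r
    using that nc[of p r] hv[of p r] by (auto simp: T' of_bool_def split: if_splits)
  have inj: "inj_on h T'"
  proof (rule inj_onI, clarify)
    fix p r p' r' assume a: "(p, r) \<in> T'" "(p', r') \<in> T'" "h (p, r) = h (p', r')"
    then have "{p, r} = {p', r'}" using supp by metis
    then show "p = p' \<and> r = r'" using a by (auto simp: T' doubleton_eq_iff)
  qed
  \<comment> \<open>The indicator of \<open>B\<close> vanishes at B + p since 0 < p < m, whereas
    \<open>h (p, r)\<close> is positive there.\<close>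
  have notin: "residue_ind m B \<notin> h ` T'"
  proof
    assume "residue_ind m B \<in> h ` T'"
    then obtain p r where pr: "(p, r) \<in> T'" "residue_ind m B = h (p, r)" by auto
    then have "residue_ind m (B + int 0) (B + int p) > 0" using supp[OF pr(1)] by auto
    then show False using pr(1) residue_ind_add_nat[of 0 p B] by (simp add: T')
  qed
  have "range ?F = insert (residue_ind m B) (h ` T')"
  proof (intro equalityI subsetI)
    fix f assume "f \<in> range ?F"
    then obtain P R where f: "f = ?F (P, R)" by auto
    define p where "p = nat ((P - B) mod int m)"
    define r where "r = nat ((R - B) mod int m)"
    have ip: "int p = (P - B) mod int m" and ir: "int r = (R - B) mod int m"
      using m2 by (auto simp: p_def r_def)
    have lt: "p < m" "r < m" using m2 by (auto simp: p_def r_def nat_less_iff)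
    have P: "[P = B + int p] (mod int m)" and R: "[R = B + int r] (mod int m)"
      unfolding ip ir by (simp_all add: cong_def mod_simps)
    have "[P + R - B = B + int (p + r)] (mod int m)"
      using cong_diff[OF cong_add[OF P R] cong_refl[of B]] by (simp add: algebra_simps)
    with P R have fh: "f = h (p, r)"
      unfolding f h_def using residue_ind_cong by auto
    have comm: "h (p, r) = h (r, p)" by (auto simp: h_def fun_eq_iff add_ac)
    consider "p = 0 \<or> r = 0" | "1 \<le> p" "p \<le> r" | "1 \<le> r" "r \<le> p" by linarith
    then show "f \<in> insert (residue_ind m B) (h ` T')"
    proof cases
      case 1
      then show ?thesis unfolding fh by (auto simp: h_def fun_eq_iff)
    next
      case 2
      then show ?thesis unfolding fh using lt T' by blast
    next
      case 3
      then show ?thesis unfolding fh comm using lt T' by blast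
    qed
  next
    fix f assume "f \<in> insert (residue_ind m B) (h ` T')"
    then consider "f = residue_ind m B" | p r where "f = h (p, r)" by auto
    then show "f \<in> range ?F"
    proof cases
      case 1
      then have "f = ?F (B, B)" by (auto simp: fun_eq_iff)
      then show ?thesis by blast
    next
      case 2
      then have "f = ?F (B + int p, B + int r)" by (auto simp: h_def fun_eq_iff add_ac)
      then show ?thesis by blast
    qed
  qed
  moreover have "finite T'" by (simp add: T'_def T_def)
  ultimately show ?thesis using notin inj card_T' by (simp add: card_image)
qed

section \<open>Counts with both or just one of the outer letters visible\<close>

lemma range_jump_entry_both:
  "range (jump_entry m True True e) =
     (SIGMA c:{0..<int m}. SIGMA d:{0..<int m}. range (jump m c d e))"
proof (intro equalityI subsetI)
  fix v assume "v \<in> range (jump_entry m True True e)"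
  then obtain c d i where v: "v = (c mod int m, d mod int m, jump m c d e i)"
    by (auto simp: jump_entry_def)
  have "jump m c d e i = jump m (c mod int m) (d mod int m) e i"
    by (rule jump_cong) (simp_all add: cong_def)
  then show "v \<in> (SIGMA c:{0..<int m}. SIGMA d:{0..<int m}. range (jump m c d e))"
    using v m2 by auto
next
  fix v assume "v \<in> (SIGMA c:{0..<int m}. SIGMA d:{0..<int m}. range (jump m c d e))"
  then obtain c d i where "c \<in> {0..<int m}" "d \<in> {0..<int m}" "v = (c, d, jump m c d e i)" by auto
  then have "v = jump_entry m True True e (c, d, i)" by (simp add: jump_entry_def)
  then show "v \<in> range (jump_entry m True True e)" by blast
qed

text \<open>Only two of the four indicators move with i, and they cancel exactly when d - e is
  congruent to c + 1.\<close>

lemma card_range_jump: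
  "card (range (jump m c d e)) = (if [d = c + 1 + e] (mod int m) then 1 else m)"
proof -
  have "jump m c d e = (\<lambda>i z. (residue_ind m (c + 1) z - residue_ind m d z)
      + (residue_ind m (d - e + i) z - residue_ind m (c + 1 + i) z))"
    by (auto simp: jump_def fun_eq_iff)
  moreover have "[d - e = c + 1] (mod int m) \<longleftrightarrow> [d = c + 1 + e] (mod int m)"
    using cong_add_rcancel[of "d - e" e "c + 1"] by simp
  ultimately show ?thesis using card_range_translates by simp
qed

lemma card_range_jump_entry_both: "card (range (jump_entry m True True e)) = m ^ 3 - m ^ 2 + m"
proof -
  have fin: "finite (range (jump m c d e))" for c d
    by (rule card_ge_0_finite) (use m2 in \<open>simp add: card_range_jump\<close>)
  have "(\<Sum>d\<in>{0..<int m}. card (range (jump m c d e))) = 1 + (m - 1) * m" for c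
  proof -
    \<comment> \<open>For each c this residue d gives a single function, and each of the other m - 1
      residues gives m.\<close>
    define d0 where "d0 = (c + 1 + e) mod int m"
    have d0: "d0 \<in> {0..<int m}" using m2 by (simp add: d0_def)
    have eq: "[d = c + 1 + e] (mod int m) \<longleftrightarrow> d = d0" if "d \<in> {0..<int m}" for d
      using that by (auto simp: d0_def cong_def)
    have "(\<Sum>d\<in>{0..<int m}. card (range (jump m c d e))) = (\<Sum>d\<in>{0..<int m}. if d = d0 then 1 else m)"
      by (rule sum.cong) (auto simp: card_range_jump eq)
    also have "\<dots> = 1 + (\<Sum>d\<in>{0..<int m} - {d0}. m)"
      using d0 by (subst sum.remove[of _ d0]) auto
    also have "\<dots> = 1 + (m - 1) * m" using d0 by (simp add: card_Diff_singleton)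
    finally show ?thesis .
  qed
  then have "card (range (jump_entry m True True e)) = m * (1 + (m - 1) * m)"
    unfolding range_jump_entry_both using fin by (simp add: card_SigmaI)
  also have "\<dots> = m ^ 3 - m ^ 2 + m"
    using m2 by (simp add: power3_eq_cube power2_eq_square algebra_simps)
  finally show ?thesis .
qed

lemma range_jump_entry_right:
  "range (jump_entry m False True e) =
     {0} \<times> (SIGMA d:{0..<int m}. range (\<lambda>(c, i). jump m c d e i))"
proof (intro equalityI subsetI)
  fix v assume "v \<in> range (jump_entry m False True e)"
  then obtain c d i where v: "v = (0, d mod int m, jump m c d e i)"
    by (auto simp: jump_entry_def)
  have "jump m c d e i = jump m c (d mod int m) e i"
    by (rule jump_cong) (simp_all add: cong_def)
  then show "v \<in> {0} \<times> (SIGMA d:{0..<int m}. range (\<lambda>(c, i). jump m c d e i))"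
    using v m2 by auto
next
  fix v assume "v \<in> {0::int} \<times> (SIGMA d:{0..<int m}. range (\<lambda>(c, i). jump m c d e i))"
  then obtain c d i where "d \<in> {0..<int m}" "v = (0, d, jump m c d e i)" by auto
  then have "v = jump_entry m False True e (c, d, i)" by (simp add: jump_entry_def)
  then show "v \<in> range (jump_entry m False True e)" by blast
qed

lemma card_range_jump_entry_right:
  "card (range (jump_entry m False True e)) = m * (1 + m * (m - 1) div 2)"
proof -
  have c: "card (range (\<lambda>(c, i). jump m c d e i)) = 1 + m * (m - 1) div 2" for d
  proof -
    \<comment> \<open>With P = c + 1 and R = d - e + i the remaining moving point c + 1 + i is P + R
      - B; the indicator of d is a fixed offset.\<close>
    define B where "B = d - e"
    let ?F = "\<lambda>(P, R) z. residue_ind m P z + residue_ind m R z - residue_ind m (P + R - B) z"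
    let ?s = "\<lambda>h z. h z - residue_ind m d z"
    have 1: "jump m c d e i = ?s (?F (c + 1, d - e + i))" for c i
      by (auto simp: jump_def fun_eq_iff B_def algebra_simps)
    have 2: "?s (?F (P, R)) = jump m (P - 1) d e (R - B)" for P R
      by (auto simp: jump_def fun_eq_iff B_def algebra_simps)
    have "range (\<lambda>(c, i). jump m c d e i) = ?s ` range ?F"
    proof (intro equalityI subsetI)
      fix v assume "v \<in> range (\<lambda>(c, i). jump m c d e i)"
      then obtain c i where "v = jump m c d e i" by auto
      then show "v \<in> ?s ` range ?F" unfolding 1 by blast
    next
      fix v assume "v \<in> ?s ` range ?F"
      then obtain P R where "v = ?s (?F (P, R))" by auto
      then have "v = (\<lambda>(c, i). jump m c d e i) (P - 1, R - B)" unfolding 2 by simp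
      then show "v \<in> range (\<lambda>(c, i). jump m c d e i)" by blast
    qed
    moreover have "card (?s ` range ?F) = card (range ?F)"
      by (intro card_image inj_onI) (simp add: fun_eq_iff)
    ultimately show ?thesis using card_range_pairs[of B] by (simp only:)
  qed
  have fin: "finite (range (\<lambda>(c, i). jump m c d e i))" for d
    by (rule card_ge_0_finite) (simp add: c)
  show ?thesis
    unfolding range_jump_entry_right card_cartesian_product using fin by (simp add: card_SigmaI c)
qed

lemma range_jump_entry_left:
  "range (jump_entry m True False e) =
     (SIGMA c:{0..<int m}. {0} \<times> range (\<lambda>(d, i). jump m c d e i))"
proof (intro equalityI subsetI)
  fix v assume "v \<in> range (jump_entry m True False e)"
  then obtain c d i where v: "v = (c mod int m, 0, jump m c d e i)"
    by (auto simp: jump_entry_def)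
  have "jump m c d e i = jump m (c mod int m) d e i"
    by (rule jump_cong) (simp_all add: cong_def)
  then show "v \<in> (SIGMA c:{0..<int m}. {0} \<times> range (\<lambda>(d, i). jump m c d e i))"
    using v m2 by auto
next
  fix v assume "v \<in> (SIGMA c:{0..<int m}. {0::int} \<times> range (\<lambda>(d, i). jump m c d e i))"
  then obtain c d i where "c \<in> {0..<int m}" "v = (c, 0, jump m c d e i)" by auto
  then have "v = jump_entry m True False e (c, d, i)" by (simp add: jump_entry_def)
  then show "v \<in> range (jump_entry m True False e)" by blast
qed

lemma card_range_jump_entry_left:
  "card (range (jump_entry m True False e)) = m * (1 + m * (m - 1) div 2)"
proof -
  have c: "card (range (\<lambda>(d, i). jump m c d e i)) = 1 + m * (m - 1) div 2" for c
  proof -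
    \<comment> \<open>The mirror image: P = c + 1 + i and R = d enter negatively, and d - e + i is P
      + R - B.\<close>
    define B where "B = c + 1 + e"
    let ?F = "\<lambda>(P, R) z. residue_ind m P z + residue_ind m R z - residue_ind m (P + R - B) z"
    let ?s = "\<lambda>h z. residue_ind m (c + 1) z - h z"
    have 1: "jump m c d e i = ?s (?F (c + 1 + i, d))" for d i
      by (auto simp: jump_def fun_eq_iff B_def algebra_simps)
    have 2: "?s (?F (P, R)) = jump m c R e (P - c - 1)" for P R
      by (auto simp: jump_def fun_eq_iff B_def algebra_simps)
    have "range (\<lambda>(d, i). jump m c d e i) = ?s ` range ?F"
    proof (intro equalityI subsetI)
      fix v assume "v \<in> range (\<lambda>(d, i). jump m c d e i)"
      then obtain d i where "v = jump m c d e i" by auto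
      then show "v \<in> ?s ` range ?F" unfolding 1 by blast
    next
      fix v assume "v \<in> ?s ` range ?F"
      then obtain P R where "v = ?s (?F (P, R))" by auto
      then have "v = (\<lambda>(d, i). jump m c d e i) (R, P - c - 1)" unfolding 2 by simp
      then show "v \<in> range (\<lambda>(d, i). jump m c d e i)" by blast
    qed
    moreover have "card (?s ` range ?F) = card (range ?F)"
      by (intro card_image inj_onI) (simp add: fun_eq_iff)
    ultimately show ?thesis using card_range_pairs[of B] by (simp only:)
  qed
  have fin: "finite (range (\<lambda>(d, i). jump m c d e i))" for c
    by (rule card_ge_0_finite) (simp add: c)
  show ?thesis
    unfolding range_jump_entry_left using fin by (simp add: card_SigmaI card_cartesian_product c)
qed

end

section \<open>Classes of borders\<close>

text \<open>A tuple \<open>(Q, i1, i0, R, j1, j0)\<close> stands for the occurrence of a factor of length \<open>n\<close> that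
  begins \<open>K i1 + i0\<close> letters before position \<open>K m Q\<close> and ends \<open>K j1 + j0\<close> letters after
  position \<open>K m R\<close>. Taking \<open>K = m\<^sup>k\<^sup>-\<^sup>1\<close> describes the borders of level \<open>k\<close>,
  while \<open>K = 1\<close> describes abelian classes.\<close>

definition cut_data :: "nat \<Rightarrow> nat \<Rightarrow> nat \<Rightarrow> (nat \<times> nat \<times> nat \<times> nat \<times> nat \<times> nat) set" where
  "cut_data m K n = {(Q, i1, i0, R, j1, j0). Q \<ge> 1 \<and> i1 < m \<and> i0 < K \<and> j1 < m \<and> j0 < K \<and>
     K * (m * R + j1) + j0 + (K * i1 + i0) = K * (m * Q) + n}"

fun cut_factor :: "nat \<Rightarrow> nat \<Rightarrow> nat \<times> nat \<times> nat \<times> nat \<times> nat \<times> nat \<Rightarrow> nat list" where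
  "cut_factor m K (Q, i1, i0, R, j1, j0) =
     tm_slice m (K * (m * Q - i1) - i0) (K * (m * R + j1) + j0)"

fun cut_border ::
    "nat \<Rightarrow> nat \<Rightarrow> nat \<times> nat \<times> nat \<times> nat \<times> nat \<times> nat \<Rightarrow> nat list \<times> nat list" where
  "cut_border m K (Q, i1, i0, R, j1, j0) =
     (tm_slice m (K * (m * Q - i1) - i0) (K * (m * Q)),
      tm_slice m (K * (m * R)) (K * (m * R + j1) + j0))"

text \<open>Within \<open>cut_data\<close> the length equation makes \<open>j0\<close> a function of
  \<open>i0\<close>, so \<open>i0\<close> stands for the lengths of both outer pieces.\<close>

fun cut_inv ::
    "nat \<Rightarrow> nat \<times> nat \<times> nat \<times> nat \<times> nat \<times> nat \<Rightarrow> nat \<times> int \<times> int \<times> (int \<Rightarrow> int)" where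
  "cut_inv m (Q, i1, i0, R, j1, j0) =
     (i0, if i0 \<noteq> 0 then int (tm m (m * Q - i1 - 1)) else 0,
      if j0 \<noteq> 0 then int (tm m (m * R + j1)) else 0,
      cyc_diff m (tm_slice m (m * Q - i1) (m * Q) @ tm_slice m (m * R) (m * R + j1)))"

lemma cut_start:
  assumes "Q \<ge> 1" "i1 < m" "i0 < K"
  shows "K * (m * Q - i1) - i0 + (K * i1 + i0) = K * (m * (Q::nat))"
    "m * Q - i1 \<ge> 1" "K * (m * Q - i1) \<ge> i0"
proof -
  have "m * 1 \<le> m * Q" using assms by (intro mult_le_mono2) simp
  then have 1: "i1 < m * Q" using assms by linarith
  then show 2: "m * Q - i1 \<ge> 1" by simp
  then have "K * 1 \<le> K * (m * Q - i1)" by (intro mult_le_mono2)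
  then show 3: "K * (m * Q - i1) \<ge> i0" using assms by linarith
  have "K * (m * Q - i1) + K * i1 = K * (m * Q)" using 1 by (simp flip: add_mult_distrib2)
  then show "K * (m * Q - i1) - i0 + (K * i1 + i0) = K * (m * Q)" using 3 by linarith
qed

lemma add_mult_unique:
  fixes K a b r s :: nat
  assumes "K * a + r = K * b + s" "r < K" "s < K"
  shows "a = b" "r = s"
proof -
  have "a = (K * a + r) div K" using assms(2) by simp
  also have "\<dots> = b" unfolding assms(1) using assms(3) by simp
  finally show "a = b" .
  then show "r = s" using assms(1) by simp
qed

context
  fixes m :: nat
  assumes m2: "m \<ge> 2"
begin

lemma cut_data_cover:
  assumes "P \<ge> 1" "K > 0"
  obtains Q i1 i0 R j1 j0 where "(Q, i1, i0, R, j1, j0) \<in> cut_data m K n"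
    "K * (m * Q - i1) - i0 = P" "K * (m * R + j1) + j0 = P + n"
proof -
  define L where "L = K * m"
  have L: "L > 0" using assms m2 by (simp add: L_def)
  \<comment> \<open>Dividing P - 1 instead of \<open>P\<close> makes \<open>Q\<close> the quotient
    of \<open>P\<close> by \<open>L\<close> rounded up, so Q \<ge> 1 and the overhang
    \<open>i\<close> is below \<open>L\<close>.\<close>
  define q where "q = (P - 1) div L"
  define r where "r = (P - 1) mod L"
  have qr: "P - 1 = L * q + r" "r < L" using L by (auto simp: q_def r_def)
  define Q where "Q = q + 1"
  define i where "i = L - 1 - r"
  have P: "P + i = L * Q" "i < L"
    using qr assms L by (simp_all add: Q_def i_def)
  define R where "R = (P + n) div L"
  define j where "j = (P + n) mod L"
  have E: "P + n = L * R + j" "j < L" using L by (auto simp: R_def j_def)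
  define i1 where "i1 = i div K"
  define i0 where "i0 = i mod K"
  define j1 where "j1 = j div K"
  define j0 where "j0 = j mod K"
  have b: "i1 < m" "i0 < K" "j1 < m" "j0 < K"
    using P(2) E(2) assms(2)
    by (auto simp: i1_def i0_def j1_def j0_def L_def less_mult_imp_div_less mult.commute)
  have ij: "i = K * i1 + i0" "j = K * j1 + j0" by (auto simp: i1_def i0_def j1_def j0_def)
  have Q: "Q \<ge> 1" by (simp add: Q_def)
  have s: "K * (m * Q - i1) - i0 = P"
    using cut_start(1)[OF Q b(1,2)] P(1) unfolding ij L_def mult.assoc by linarith
  have e: "K * (m * R + j1) + j0 = P + n"
    unfolding E(1) ij by (simp add: L_def algebra_simps)
  have "(Q, i1, i0, R, j1, j0) \<in> cut_data m K n"
    using Q b e P(1) unfolding cut_data_def ij by (simp add: L_def mult.assoc)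
  then show ?thesis using s e that by blast
qed

lemma cut_data_end:
  assumes "(Q, i1, i0, R, j1, j0) \<in> cut_data m K n"
  shows "K * (m * R + j1) + j0 = K * (m * Q - i1) - i0 + n"
  using assms cut_start(1)[of Q i1 m i0 K] by (auto simp: cut_data_def)

section \<open>Factors, borders and their equivalence in terms of cuts\<close>

lemma factors_eq_cut_factor:
  assumes "K > 0"
  shows "factors m n = cut_factor m K ` cut_data m K n"
proof (intro equalityI subsetI)
  fix U assume "U \<in> factors m n"
  then obtain P where P: "P \<ge> 1" "U = tm_slice m P (P + n)" by (auto simp: factors_eq[OF m2])
  obtain Q i1 i0 R j1 j0 where "(Q, i1, i0, R, j1, j0) \<in> cut_data m K n"
    "K * (m * Q - i1) - i0 = P" "K * (m * R + j1) + j0 = P + n"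
    using cut_data_cover[OF P(1) assms] by blast
  then show "U \<in> cut_factor m K ` cut_data m K n"
    by (intro image_eqI[of _ _ "(Q, i1, i0, R, j1, j0)"]) (simp_all only: cut_factor.simps P(2))
next
  fix U assume "U \<in> cut_factor m K ` cut_data m K n"
  then obtain Q i1 i0 R j1 j0 where D: "(Q, i1, i0, R, j1, j0) \<in> cut_data m K n"
    and U: "U = cut_factor m K (Q, i1, i0, R, j1, j0)" by auto
  show "U \<in> factors m n"
    unfolding U cut_factor.simps cut_data_end[OF D]
    by (auto simp: factors_def is_factor_def)
qed

lemma border_cut_factor:
  assumes "n \<ge> 2 * m ^ Suc k" "D \<in> cut_data m (m ^ k) n"
  shows "border m (Suc k) (cut_factor m (m ^ k) D) = cut_border m (m ^ k) D"
proof -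
  obtain Q i1 i0 R j1 j0 where D: "D = (Q, i1, i0, R, j1, j0)" by (cases D)
  define K where "K = m ^ k"
  have d: "Q \<ge> 1" "i1 < m" "i0 < K" "j1 < m" "j0 < K"
    using assms(2) by (auto simp: cut_data_def D K_def)
  have K: "m ^ Suc k = K * m" by (simp add: K_def)
  have lt: "K * i1 + i0 < m ^ Suc k" "K * j1 + j0 < m ^ Suc k"
    unfolding K
    using mult_le_mono2[of "Suc i1" m K] mult_le_mono2[of "Suc j1" m K] d by auto
  define P where "P = K * (m * Q - i1) - i0"
  have E: "K * (m * R + j1) + j0 = P + n"
    using cut_data_end assms(2) unfolding P_def D K_def by blast
  have s: "P + (K * i1 + i0) = m ^ Suc k * Q"
    using cut_start(1)[OF d(1-3)] unfolding K P_def by (simp add: mult.assoc)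
  have t: "P + n = m ^ Suc k * R + (K * j1 + j0)"
    using E unfolding K by (simp add: algebra_simps)
  show ?thesis
    using border_tm_slice[OF m2 s lt(1) t lt(2) assms(1)]
    unfolding D cut_factor.simps cut_border.simps K_def[symmetric] E P_def[symmetric] K mult.assoc .
qed

text \<open>Outer pieces shorter than m^k have the remainder of the length division as length, so
  each border splits in only one way, with preimages unique by injectivity.\<close>

lemma border_equiv_decomp:
  assumes w: "x \<in> words m" "y \<in> words m" "p \<in> words m" "q \<in> words m"
    "x' \<in> words m" "y' \<in> words m" "p' \<in> words m" "q' \<in> words m"
    and len: "length x < m ^ k" "length y < m ^ k" "length x' < m ^ k" "length y' < m ^ k"
  shows "border_equiv m (Suc k) (x @ sigma_pow m k p, sigma_pow m k q @ y)
      (x' @ sigma_pow m k p', sigma_pow m k q' @ y') \<longleftrightarrow>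
    x = x' \<and> y = y' \<and>
    (abelian_equiv (p @ q) (p' @ q') \<or> abelian_equiv (p @ q) (p' @ q' @ sigma m [0]) \<or>
     abelian_equiv (p @ q @ sigma m [0]) (p' @ q'))" (is "?L \<longleftrightarrow> ?R")
proof
  assume R: ?R
  show ?L
    unfolding border_equiv_def
    by (rule bexI[of _ x], rule bexI[of _ y], rule bexI[of _ p], rule bexI[of _ q],
        rule bexI[of _ p'], rule bexI[of _ q']) (use R w len in auto)
next
  have l: "a = b \<and> u = v"
    if "a @ sigma_pow m k u = b @ sigma_pow m k v" "u \<in> words m" "v \<in> words m"
      "length a < m ^ k" "length b < m ^ k" for a b u v
  proof -
    have "m ^ k * length u + length a = m ^ k * length v + length b"
      using arg_cong[OF that(1), of length] by (simp add: length_sigma_pow)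
    from add_mult_unique[OF this] that show ?thesis
      using inj_on_sigma_pow[OF m2, of k] by (auto dest: inj_onD)
  qed
  have r: "a = b \<and> u = v"
    if "sigma_pow m k u @ a = sigma_pow m k v @ b" "u \<in> words m" "v \<in> words m"
      "length a < m ^ k" "length b < m ^ k" for a b u v
  proof -
    have "m ^ k * length u + length a = m ^ k * length v + length b"
      using arg_cong[OF that(1), of length] by (simp add: length_sigma_pow)
    from add_mult_unique[OF this] that show ?thesis
      using inj_on_sigma_pow[OF m2, of k] by (auto dest: inj_onD)
  qed
  assume ?L
  then obtain X Y P Q R T where W: "X \<in> words m" "Y \<in> words m" "P \<in> words m" "Q \<in> words m"
      "R \<in> words m" "T \<in> words m"
    and ln: "length X < m ^ k" "length Y < m ^ k"
    and e: "x @ sigma_pow m k p = X @ sigma_pow m k P" "sigma_pow m k q @ y = sigma_pow m k Q @ Y"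
      "x' @ sigma_pow m k p' = X @ sigma_pow m k R" "sigma_pow m k q' @ y' = sigma_pow m k T @ Y"
    and ab: "abelian_equiv (P @ Q) (R @ T) \<or> abelian_equiv (P @ Q) (R @ T @ sigma m [0]) \<or>
      abelian_equiv (P @ Q @ sigma m [0]) (R @ T)"
    unfolding border_equiv_def by (simp only: diff_Suc_1 prod.inject) blast
  show ?R
    using l[OF e(1)] r[OF e(2)] l[OF e(3)] r[OF e(4)] w len W ln ab by metis
qed

lemma cut_border_equiv_iff:
  assumes "D \<in> cut_data m (m ^ k) n" "D' \<in> cut_data m (m ^ k) n"
  shows "border_equiv m (Suc k) (cut_border m (m ^ k) D) (cut_border m (m ^ k) D') \<longleftrightarrow>
    cut_inv m D = cut_inv m D'"
proof -
  define K where "K = m ^ k"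
  obtain Q i1 i0 R j1 j0 where D: "D = (Q, i1, i0, R, j1, j0)" by (cases D)
  obtain Q' i1' i0' R' j1' j0' where D': "D' = (Q', i1', i0', R', j1', j0')" by (cases D')
  have d: "Q \<ge> 1" "i1 < m" "i0 < K" "j1 < m" "j0 < K"
    "K * (m * R + j1) + j0 + (K * i1 + i0) = K * (m * Q) + n"
    using assms(1) by (auto simp: cut_data_def D K_def)
  have d': "Q' \<ge> 1" "i1' < m" "i0' < K" "j1' < m" "j0' < K"
    "K * (m * R' + j1') + j0' + (K * i1' + i0') = K * (m * Q') + n"
    using assms(2) by (auto simp: cut_data_def D' K_def)
  have dec: "cut_border m K (Q, i1, i0, R, j1, j0) =
      (tm_slice m (K * (m * Q - i1) - i0) (K * (m * Q - i1)) @ sigma_pow m k (tm_slice m (m * Q - i1) (m * Q)),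
       sigma_pow m k (tm_slice m (m * R) (m * R + j1)) @ tm_slice m (K * (m * R + j1)) (K * (m * R + j1) + j0))"
    for Q i1 i0 R j1 j0
    unfolding sigma_pow_tm_slice[OF m2] K_def[symmetric] cut_border.simps
    by (simp add: tm_slice_append[OF m2])
  \<comment> \<open>Modulo \<open>K\<close> both length equations give i0 + j0 and i0' + j0' the
    same residue.\<close>
  have j0: "j0 = j0'" if "i0 = i0'"
  proof -
    have "j0 + i0 + K * (m * R + j1 + i1 + m * Q') = K * (m * Q) + n + K * (m * Q')"
      using d(6) by (simp add: algebra_simps)
    also have "\<dots> = j0' + i0' + K * (m * R' + j1' + i1' + m * Q)"
      using d'(6) by (simp add: algebra_simps)
    finally have "K * (m * R + j1 + i1 + m * Q') + j0 = K * (m * R' + j1' + i1' + m * Q) + j0'"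
      using that by linarith
    from add_mult_unique(2)[OF this d(5) d'(5)] show ?thesis .
  qed
  let ?x = "tm_slice m (K * (m * Q - i1) - i0) (K * (m * Q - i1))"
  let ?x' = "tm_slice m (K * (m * Q' - i1') - i0') (K * (m * Q' - i1'))"
  let ?y = "tm_slice m (K * (m * R + j1)) (K * (m * R + j1) + j0)"
  let ?y' = "tm_slice m (K * (m * R' + j1')) (K * (m * R' + j1') + j0')"
  let ?p = "tm_slice m (m * Q - i1) (m * Q)"
  let ?p' = "tm_slice m (m * Q' - i1') (m * Q')"
  let ?q = "tm_slice m (m * R) (m * R + j1)"
  let ?q' = "tm_slice m (m * R') (m * R' + j1')"
  note st = cut_start[OF d(1-3)]
  note st' = cut_start[OF d'(1-3)]
  have lx: "length ?x = i0" "length ?x' = i0'" using st(3) st'(3) by auto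
  have ly: "length ?y = j0" "length ?y' = j0'" by auto
  \<comment> \<open>Fewer than m letters on each side: this is the bound under which the three
    alternatives amount to equal cyclic differences.\<close>
  have lpq: "length (?p @ ?q) < 2 * m" "length (?p' @ ?q') < 2 * m" using d d' by auto
  note tw = tm_slice_words[OF m2]
  have "border_equiv m (Suc k) (cut_border m K D) (cut_border m K D') \<longleftrightarrow>
      ?x = ?x' \<and> ?y = ?y' \<and> cyc_diff m (?p @ ?q) = cyc_diff m (?p' @ ?q')"
    unfolding D D' dec
    by (subst border_equiv_decomp)
      (use lx ly d d' tw abelian_equiv_sigma_iff_cyc_diff[OF m2 words_append[OF tw tw] words_append[OF tw tw] lpq]
        in \<open>simp_all only: K_def append_assoc\<close>)
  also have "\<dots> \<longleftrightarrow> cut_inv m D = cut_inv m D'"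
  proof (cases "i0 = i0'")
    case True
    show ?thesis
      unfolding D D' cut_inv.simps True[symmetric] j0[OF True, symmetric]
      using tm_slice_before_eq_iff[OF m2 st(2) st'(2), of i0 k] d(3,5)
        tm_slice_after_eq_iff[OF m2, of j0 k "m * R + j1" "m * R' + j1'"]
      by (auto simp: K_def)
  next
    case False
    then have "?x \<noteq> ?x'" using lx by metis
    then show ?thesis using False by (simp add: D D')
  qed
  finally show ?thesis by (simp only: K_def)
qed

lemma card_border_classes:
  assumes "n \<ge> 2 * m ^ Suc k"
  shows "card (border_classes m (Suc k) n) = card (cut_inv m ` cut_data m (m ^ k) n)"
proof -
  have "border m (Suc k) ` factors m n = cut_border m (m ^ k) ` cut_data m (m ^ k) n"
    unfolding factors_eq_cut_factor[of "m ^ k" n, OF zero_less_power[of m k, OF order.strict_trans2[OF pos2 m2]]]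
      image_image
    using border_cut_factor[OF assms] by (intro image_cong) auto
  then show ?thesis
    unfolding border_classes_def Let_def
    using card_quotient_image[of "cut_data m (m ^ k) n" "border_equiv m (Suc k)" "cut_border m (m ^ k)" "cut_inv m"]
      cut_border_equiv_iff by simp
qed

text \<open>For K = 1 the outer pieces vanish and a factor is p \<sigma>(u) q, whose middle part
  does not affect the cyclic difference; n \<ge> m keeps the two cuts in order.\<close>

lemma abelian_complexity_eq_cut_inv:
  assumes "n \<ge> m"
  shows "abelian_complexity m n = card (cut_inv m ` cut_data m 1 n)"
proof -
  have cd: "cyc_diff m (cut_factor m 1 (Q, i1, i0, R, j1, j0)) =
      cyc_diff m (tm_slice m (m * Q - i1) (m * Q) @ tm_slice m (m * R) (m * R + j1))
      \<and> length (cut_factor m 1 (Q, i1, i0, R, j1, j0)) = n \<and> i0 = 0 \<and> j0 = 0"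
    if "(Q, i1, i0, R, j1, j0) \<in> cut_data m 1 n" for Q i1 i0 R j1 j0
  proof -
    have d: "i0 = 0" "j0 = 0" "i1 < m" "j1 < m" "m * R + j1 + i1 = m * Q + n"
      using that by (auto simp: cut_data_def)
    then have "m * Q < m * (R + 1)" using assms by simp
    then have QR: "Q \<le> R" by (simp only: mult_less_cancel1) simp
    have "cut_factor m 1 (Q, i1, i0, R, j1, j0) =
        tm_slice m (m * Q - i1) (m * Q) @ sigma m (tm_slice m Q R) @ tm_slice m (m * R) (m * R + j1)"
    proof -
      have "m * Q - i1 \<le> m * Q" "m * Q \<le> m * R" "m * R \<le> m * R + j1" using QR by auto
      moreover have "cut_factor m 1 (Q, i1, i0, R, j1, j0) = tm_slice m (m * Q - i1) (m * R + j1)"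
        using d by simp
      ultimately show ?thesis
        unfolding sigma_tm_slice[OF m2] by (metis le_trans tm_slice_append[OF m2])
    qed
    moreover have "length (cut_factor m 1 (Q, i1, i0, R, j1, j0)) = n"
      using cut_data_end[OF that] by simp
    ultimately show ?thesis
      using d by (auto simp: cyc_diff_append cyc_diff_sigma[OF m2] fun_eq_iff)
  qed
  have "abelian_equiv (cut_factor m 1 D) (cut_factor m 1 D') \<longleftrightarrow> cut_inv m D = cut_inv m D'"
    if D: "D \<in> cut_data m 1 n" and D': "D' \<in> cut_data m 1 n" for D D'
  proof -
    obtain Q i1 i0 R j1 j0 where e: "D = (Q, i1, i0, R, j1, j0)" by (cases D)
    obtain Q' i1' i0' R' j1' j0' where e': "D' = (Q', i1', i0', R', j1', j0')" by (cases D')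
    have w: "cut_factor m 1 D \<in> words m" "cut_factor m 1 D' \<in> words m"
      unfolding e e' cut_factor.simps by (rule tm_slice_words[OF m2])+
    note c = cd[OF D[unfolded e]]
    note c' = cd[OF D'[unfolded e']]
    have "abelian_equiv (cut_factor m 1 D) (cut_factor m 1 D') \<longleftrightarrow>
        cyc_diff m (cut_factor m 1 D) = cyc_diff m (cut_factor m 1 D')"
      by (rule abelian_equiv_iff_cyc_diff[OF m2 w]) (unfold e e', use c c' in metis)
    also have "\<dots> \<longleftrightarrow> cut_inv m D = cut_inv m D'"
      unfolding e e' c[THEN conjunct1] c'[THEN conjunct1] cut_inv.simps using c c' by simp
    finally show ?thesis .
  qed
  then show ?thesis
    unfolding abelian_complexity_def factors_eq_cut_factor[of 1 n, simplified] 
    using card_quotient_image[of "cut_data m 1 n" abelian_equiv "cut_factor m 1" "cut_inv m"] by simp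
qed

section \<open>The realised values of the invariant\<close>

lemma cut_inv_eq_jump_entry:
  assumes "Q \<ge> 1" "i1 < m" "j1 < m" and e: "[int i1 + int j1 = e] (mod int m)"
  shows "cut_inv m (Q, i1, i0, R, j1, j0) =
    (i0, jump_entry m (i0 \<noteq> 0) (j0 \<noteq> 0) e
      (int (tm m (Q - 1)) - 1 - int i1, int (tm m R) + int j1, int i1))"
proof -
  have tl: "int (tm m (m * (Q - 1) + r)) = (int (tm m (Q - 1)) + int r) mod int m" if "r < m" for r
    using tm_mult_add[OF m2 that, of "Q - 1"] by (simp add: zmod_int)
  have Q: "m * Q = m * (Q - 1) + m" using assms(1) by (cases Q) auto
  have c: "int (tm m (m * Q - i1 - 1)) = (int (tm m (Q - 1)) - 1 - int i1) mod int m"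
  proof -
    have "m * Q - i1 - 1 = m * (Q - 1) + (m - 1 - i1)" using Q assms by simp
    moreover have "(int (tm m (Q - 1)) + int (m - 1 - i1)) mod int m
        = (int (tm m (Q - 1)) - 1 - int i1 + int m) mod int m"
      using assms by (simp add: of_nat_diff algebra_simps)
    ultimately show ?thesis using tl[of "m - 1 - i1"] assms by simp
  qed
  have d: "int (tm m (m * R + j1)) = (int (tm m R) + int j1) mod int m"
    using tm_mult_add[OF m2 assms(3), of R] by (simp add: zmod_int)
  have p: "cyc_diff m (tm_slice m (m * Q - i1) (m * Q)) z =
      residue_ind m (int (tm m (Q - 1)) - int i1) z - residue_ind m (int (tm m (Q - 1))) z" for z
  proof -
    have "cyc_diff m (tm_slice m (m * Q - i1) (m * Q)) z =
      residue_ind m (int (tm m (Q - 1)) - int i1) z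
      - residue_ind m (int (tm m (Q - 1)) - int i1 + int (length (tm_slice m (m * Q - i1) (m * Q)))) z"
    proof (rule cyc_diff_run[OF m2])
      fix l assume "l < length (tm_slice m (m * Q - i1) (m * Q))"
      then have l: "l < i1" by simp
      then have 1: "m * Q - i1 + l < m * Q" "m * Q - i1 + l = m * (Q - 1) + (m - i1 + l)" "m - i1 + l < m"
        using Q assms(2) by auto
      have "int (m - i1 + l) = int m - int i1 + int l" using assms(2) by simp
      then have "[int (tm m (m * Q - i1 + l)) = int (tm m (Q - 1)) - int i1 + int l] (mod int m)"
        unfolding 1(2) tl[OF 1(3)] by (simp add: cong_def mod_simps) (smt (verit) mod_add_self2)
      then show "tm_slice m (m * Q - i1) (m * Q) ! l < m \<and>
          [int (tm_slice m (m * Q - i1) (m * Q) ! l) = int (tm m (Q - 1)) - int i1 + int l] (mod int m)"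
        using 1(1) tm_less[OF m2] by simp
    qed
    then show ?thesis using Q assms(2) by simp
  qed
  have q: "cyc_diff m (tm_slice m (m * R) (m * R + j1)) z =
      residue_ind m (int (tm m R)) z - residue_ind m (int (tm m R) + int j1) z" for z
  proof -
    have "cyc_diff m (tm_slice m (m * R) (m * R + j1)) z =
      residue_ind m (int (tm m R)) z
      - residue_ind m (int (tm m R) + int (length (tm_slice m (m * R) (m * R + j1)))) z"
      by (rule cyc_diff_run[OF m2])
        (use assms(3) tm_mult_add[OF m2, of _ R] tm_less[OF m2] m2 in \<open>auto simp: cong_def zmod_int\<close>)
    then show ?thesis by simp
  qed
  have "[int (tm m R) = int (tm m R) + int j1 - e + int i1] (mod int m)"
  proof -
    have "[int (tm m R) - e + (int i1 + int j1) = int (tm m R) - e + e] (mod int m)"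
      using e by (intro cong_add) auto
    then show ?thesis by (simp add: cong_sym algebra_simps)
  qed
  note r = residue_ind_cong[OF this]
  \<comment> \<open>Modulo m, the run p starts at c + 1 and ends before c + 1 + i1, the letter at Q
    - 1; the run q starts at d - e + i1, the letter at \<open>R\<close>, and ends before d.\<close>
  have j: "jump m (int (tm m (Q - 1)) - 1 - int i1) (int (tm m R) + int j1) e (int i1) =
      cyc_diff m (tm_slice m (m * Q - i1) (m * Q) @ tm_slice m (m * R) (m * R + j1))"
    by (rule ext) (simp add: cyc_diff_append p q jump_def r)
  show ?thesis
    unfolding cut_inv.simps jump_entry_def by (simp only: c d j prod.case)
qed

lemma jump_entry_cong:
  assumes "[c = c'] (mod int m)" "[d = d'] (mod int m)" "[i = i'] (mod int m)"
  shows "jump_entry m x y e (c, d, i) = jump_entry m x y e (c', d', i')"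
  using assms jump_cong[OF assms(1,2) cong_refl assms(3)] by (auto simp: jump_entry_def cong_def)

lemma finite_range_jump_entry: "finite (range (jump_entry m x y e))"
proof (rule finite_subset)
  let ?I = "{0..<int m}"
  show "range (jump_entry m x y e) \<subseteq> jump_entry m x y e ` (?I \<times> ?I \<times> ?I)"
  proof
    fix v assume "v \<in> range (jump_entry m x y e)"
    then obtain c d i where v: "v = jump_entry m x y e (c, d, i)" by auto
    have "jump_entry m x y e (c, d, i) = jump_entry m x y e (c mod int m, d mod int m, i mod int m)"
      by (rule jump_entry_cong) (simp_all add: cong_def)
    then show "v \<in> jump_entry m x y e ` (?I \<times> ?I \<times> ?I)"
      unfolding v using m2 by (intro image_eqI) auto
  qed
qed simp

text \<open>For given \<open>i0\<close> the length \<open>n\<close> determines \<open>j0\<close> and the residue of \<open>i1 + j1\<close>; the remaining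
  parameters are free because every pair of letters occurs at every distance.\<close>

lemma cut_inv_image:
  assumes n: "n = K * (m * w + nu) + mu" and w: "w \<ge> 1" and nu: "nu < m" and mu: "mu < K"
  shows "cut_inv m ` cut_data m K n =
    (SIGMA i0:{..<K}. range (jump_entry m (i0 \<noteq> 0) (i0 \<noteq> mu) (int nu - of_bool (mu < i0))))"
    (is "_ = ?rhs")
proof (intro equalityI subsetI)
  fix v assume "v \<in> cut_inv m ` cut_data m K n"
  then obtain Q i1 i0 R j1 j0 where D: "(Q, i1, i0, R, j1, j0) \<in> cut_data m K n"
    and v: "v = cut_inv m (Q, i1, i0, R, j1, j0)" by auto
  have d: "Q \<ge> 1" "i1 < m" "i0 < K" "j1 < m" "j0 < K"
    "K * (m * R + j1 + i1) + (i0 + j0) = K * (m * Q + m * w + nu) + mu"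
    using D by (auto simp: cut_data_def n algebra_simps)
  \<comment> \<open>The low parts i0 and j0 add up to mu or to mu + K; the latter, a carry, happens
    exactly if mu < i0.\<close>
  have key: "m * R + j1 + i1 + of_bool (mu < i0) = m * (Q + w) + nu \<and> (j0 = 0 \<longleftrightarrow> i0 = mu)"
  proof (cases "i0 + j0 < K")
    case True
    from add_mult_unique[OF d(6) True mu] show ?thesis by (auto simp: algebra_simps)
  next
    case False
    then have "K * (m * R + j1 + i1 + 1) + (i0 + j0 - K) = K * (m * Q + m * w + nu) + mu"
      using d(6) by (simp add: algebra_simps)
    moreover have "i0 + j0 - K < K" using d by simp
    ultimately have "m * R + j1 + i1 + 1 = m * Q + m * w + nu" "i0 + j0 - K = mu"
      using add_mult_unique[OF _ _ mu] by blast+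
    then show ?thesis using d False by (auto simp: algebra_simps)
  qed
  define e where "e = int nu - of_bool (mu < i0)"
  have "[int i1 + int j1 = e] (mod int m)"
  proof -
    have "int (m * R + j1 + i1 + of_bool (mu < i0)) = int (m * (Q + w) + nu)" using key by presburger
    then have "int i1 + int j1 = e + int m * (int Q + int w - int R)"
      by (simp add: e_def algebra_simps)
    then show ?thesis by (simp add: cong_def)
  qed
  from cut_inv_eq_jump_entry[OF d(1,2,4) this, of i0 R j0] key d(3)
  show "v \<in> ?rhs" unfolding v e_def by auto
next
  fix v assume "v \<in> ?rhs"
  then obtain i0 c d i where i0: "i0 < K"
    and v: "v = (i0, jump_entry m (i0 \<noteq> 0) (i0 \<noteq> mu) (int nu - of_bool (mu < i0)) (c, d, i))"
    by auto
  define e where "e = int nu - of_bool (mu < i0)"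
  define i1 where "i1 = nat (i mod int m)"
  define j1 where "j1 = nat ((e - i) mod int m)"
  define j0 where "j0 = (if i0 \<le> mu then mu - i0 else mu + K - i0)"
  \<comment> \<open>Here c = a - 1 - i1 and d = b + j1 are solved modulo m for the letters wanted at
    Q - 1 and at \<open>R\<close>.\<close>
  define a where "a = nat ((c + 1 + i) mod int m)"
  define b where "b = nat ((d - (e - i)) mod int m)"
  have int: "int i1 = i mod int m" "int j1 = (e - i) mod int m"
    "int a = (c + 1 + i) mod int m" "int b = (d - (e - i)) mod int m"
    using m2 by (auto simp: i1_def j1_def a_def b_def)
  have lt: "i1 < m" "j1 < m" "a < m" "b < m"
    using m2 by (auto simp: i1_def j1_def a_def b_def nat_less_iff)
  have e: "[int i1 + int j1 = e] (mod int m)"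
    unfolding int by (simp add: cong_def mod_simps)
  have j0: "j0 < K" "i0 + j0 = mu + (if mu < i0 then K else 0)" "j0 \<noteq> 0 \<longleftrightarrow> i0 \<noteq> mu"
    using i0 mu by (auto simp: j0_def)
  \<comment> \<open>\<open>D\<close> will be R - Q; it is a natural number because s < 2m subtracts
    at most one block and w \<ge> 1.\<close>
  obtain D where D: "m * D + (i1 + j1 + of_bool (mu < i0)) = m * w + nu"
  proof -
    define s where "s = i1 + j1 + of_bool (mu < i0)"
    have "[int s = int nu] (mod int m)"
      using cong_add[OF e cong_refl[of "of_bool (mu < i0)"]] by (simp add: s_def e_def)
    then have "[s = nu] (mod m)" by (simp only: cong_int_iff)
    then have s: "s mod m = nu" using nu by (simp add: cong_def)
    have "s < 2 * m" using lt by (auto simp: s_def)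
    then have "s div m < 2" by (simp add: less_mult_imp_div_less)
    then have "s div m \<le> w" using w by simp
    then have "m * (w - s div m) + s = m * w + nu"
      using s mult_div_mod_eq[of m s] by (simp add: diff_mult_distrib2 flip: add.assoc)
    then show ?thesis using that s_def by blast
  qed
  \<comment> \<open>The prescribed letters sit at Q - 1 and \<open>R\<close>, whose distance D + 1
    is positive even if D = 0.\<close>
  obtain N where N: "tm m N = a" "tm m (N + (D + 1)) = b"
    using ex_tm_pair[OF m2 _ lt(3,4), of "D + 1"] by auto
  define Q where "Q = N + 1"
  define R where "R = N + (D + 1)"
  have "K * (m * R + j1) + j0 + (K * i1 + i0) = K * (m * Q) + n"
  proof -
    have "K * (m * R + j1) + j0 + (K * i1 + i0) =
        K * (m * Q) + K * (m * D + (i1 + j1 + of_bool (mu < i0))) + mu"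
      using j0(2) by (auto simp: Q_def R_def algebra_simps)
    then show ?thesis unfolding D n by simp
  qed
  then have mem: "(Q, i1, i0, R, j1, j0) \<in> cut_data m K n"
    using lt i0 j0 by (simp add: cut_data_def Q_def)
  have ci: "[int i1 = i] (mod int m)" "[int j1 = e - i] (mod int m)"
    "[int a = c + 1 + i] (mod int m)" "[int b = d - (e - i)] (mod int m)"
    unfolding int by (simp_all add: cong_def)
  have "[int a - 1 - int i1 = c] (mod int m)" "[int b + int j1 = d] (mod int m)"
    using cong_diff[OF cong_diff[OF ci(3) cong_refl[of 1]] ci(1)] cong_add[OF ci(4) ci(2)] by simp_all
  with ci(1) have "cut_inv m (Q, i1, i0, R, j1, j0) = v"
    using cut_inv_eq_jump_entry[OF _ lt(1,2) e, of Q i0 R j0] jump_entry_cong N j0(3)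
    unfolding v e_def by (simp add: Q_def R_def)
  then show "v \<in> cut_inv m ` cut_data m K n" using mem by (metis imageI)
qed

end

section \<open>Summation over the length of the left outer piece\<close>

theorem theorem6p5:
  fixes m k n lam nu mu :: nat
  assumes "m \<ge> 2" and "k \<ge> 2" and "n \<ge> 2 * m ^ k"
    and "lam = n mod m ^ k"
    and "lam = nu * m ^ (k - 1) + mu"
    and "nu < m" and "mu < m ^ (k - 1)"
  shows "card (border_classes m k n) =
    (m ^ (k - 1) - 1) * (m ^ 3 - m ^ 2 + m)
    + (if mu = 0 then abelian_complexity m (m + nu) else m)"
proof -
  define k' where "k' = k - 1"
  have k: "k = Suc k'" using assms(2) by (simp add: k'_def)
  define K where "K = m ^ k'"
  define w where "w = n div m ^ k"
  have "m ^ k * 2 \<le> n" using assms(3) by simp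
  then have w: "w \<ge> 1"
    using assms(1) div_le_mono[of "m ^ k * 2" n "m ^ k"] by (simp add: w_def)
  have "n = m ^ k * w + lam" using assms(4) by (simp add: w_def)
  then have n: "n = K * (m * w + nu) + mu"
    by (simp add: assms(5) K_def k algebra_simps)
  have mu: "mu < K" using assms(7) by (simp add: K_def k)
  let ?J = "\<lambda>i0. range (jump_entry m (i0 \<noteq> 0) (i0 \<noteq> mu) (int nu - of_bool (mu < i0)))"
  define g where "g = m ^ 3 - m ^ 2 + m"
  have cls: "card (border_classes m k n) = card (SIGMA i0:{..<K}. ?J i0)"
    using card_border_classes[OF assms(1), of k' n] assms(3)
      cut_inv_image[OF assms(1) n w assms(6) mu] by (simp add: k K_def)
  have gen: "card (?J i0) = g" if "i0 \<noteq> 0" "i0 \<noteq> mu" for i0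
    using that card_range_jump_entry_both[OF assms(1)] by (simp add: g_def)
  \<comment> \<open>The case K = 1, w = 1, mu = 0 of the same description, in which no outer letter
    is visible.\<close>
  have ab: "abelian_complexity m (m + nu) = card (range (jump_entry m False False (int nu)))"
  proof -
    have "abelian_complexity m (m + nu) = card (cut_inv m ` cut_data m 1 (m + nu))"
      using abelian_complexity_eq_cut_inv[OF assms(1)] by simp
    also have "cut_inv m ` cut_data m 1 (m + nu) = {0} \<times> range (jump_entry m False False (int nu))"
      by (subst cut_inv_image[OF assms(1), of _ _ 1 nu 0])
        (use assms(6) in \<open>auto simp: lessThan_Suc\<close>)
    finally show ?thesis by (simp add: card_cartesian_product)
  qed
  \<comment> \<open>The two lengths with just one visible letter together give one generic
    contribution plus the final m of the formula.\<close>
  have half: "m * (1 + m * (m - 1) div 2) + m * (1 + m * (m - 1) div 2) = g + m"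
  proof -
    define h where "h = m * (m - 1) div 2"
    have "even (m * (m - 1))" by auto
    then have h: "2 * h = m * (m - 1)" by (simp add: h_def)
    have "m * (1 + h) + m * (1 + h) = 2 * m + m * (2 * h)" by (simp add: algebra_simps)
    also have "\<dots> = g + m"
      unfolding h using assms(1)
      by (cases m) (simp_all add: g_def power3_eq_cube power2_eq_square algebra_simps)
    finally show ?thesis by (simp add: h_def)
  qed
  have sum: "card (border_classes m k n) = (\<Sum>i0<K. card (?J i0))"
    unfolding cls using finite_range_jump_entry[OF assms(1)] by (subst card_SigmaI) auto
  show ?thesis
  proof (cases "mu = 0")
    case True
    have "(\<Sum>i0<K. card (?J i0)) = card (?J 0) + (\<Sum>i0\<in>{..<K} - {0}. card (?J i0))"
      using mu by (subst sum.remove[of _ 0]) auto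
    also have "(\<Sum>i0\<in>{..<K} - {0}. card (?J i0)) = (\<Sum>i0\<in>{..<K} - {0}. g)"
      by (rule sum.cong) (use gen True in auto)
    finally show ?thesis
      using True mu sum ab by (simp add: g_def K_def k)
  next
    case False
    \<comment> \<open>For i0 = 0 the left outer piece is empty, for i0 = mu the right one; all other
      lengths are generic.\<close>
    have "(\<Sum>i0<K. card (?J i0)) = card (?J 0) + (card (?J mu) + (\<Sum>i0\<in>{..<K} - {0} - {mu}. card (?J i0)))"
      using mu False by (subst sum.remove[of _ 0], simp, simp, subst sum.remove[of _ mu]) auto
    also have "(\<Sum>i0\<in>{..<K} - {0} - {mu}. card (?J i0)) = (\<Sum>i0\<in>{..<K} - {0} - {mu}. g)"
      by (rule sum.cong) (use gen in auto)
    also have "\<dots> = (K - 2) * g" using mu False by (simp add: card_Diff_singleton numeral_2_eq_2)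
    also have "card (?J 0) = m * (1 + m * (m - 1) div 2)"
      using card_range_jump_entry_right[OF assms(1)] False by simp
    also have "card (?J mu) = m * (1 + m * (m - 1) div 2)"
      using card_range_jump_entry_left[OF assms(1)] False by simp
    finally have "(\<Sum>i0<K. card (?J i0)) = g + m + (K - 2) * g" using half by simp
    also have "\<dots> = (K - 1) * g + m"
    proof -
      have "K - 1 = Suc (K - 2)" using mu False by simp
      then show ?thesis by simp
    qed
    finally show ?thesis using sum False by (simp add: g_def K_def k)
  qed
qed

end
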